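(* A Hausdorff space $X$ is very I-favorable if and only if $X$ is an almost limit of a $\sigma$-complete inverse system $S=\{X_A,q^A_B,\mathcal C\}$ in which every $X_A$ is a (not necessarily Hausdorff) topological space of countable weight and all bonding maps $q^A_B$ are d-open and surjective.
   Context: For a family $\mathcal P$ of open subsets of $X$ contained in a family $\mathcal Q$ of open subsets of $X$, write $\mathcal P\subset_!\mathcal Q$ if for every subfamily $\mathcal S\subset\mathcal P$ and every point $x\notin\operatorname{cl}_X\bigcup\mathcal S$ there exists $W\in\mathcal P$ with $x\in W$ and $W\cap\bigcup\mathcal S=\emptyset$. $[\mathcal Q]^{\le\omega}$ denotes the set of countable subfamilies of $\mathcal Q$. A family $\mathcal C\subset[\mathcal Q]^{\le\omega}$ is a club if (i) for every increasing sequence $C_1\subset C_2\subset\cdots$ in $\mathcal C$, $\bigcup_nC_n\in\mathcal C$, and (ii) every $B\in[\mathcal Q]^{\le\omega}$ is contained in some $C\in\mathcal C$. A space $X$ with topology $\mathcal T_X$ is very I-favorable if $\{\mathcal P\in[\mathcal T_X]^{\le\omega}:\mathcal P\subset_!\mathcal T_X\}$ contains a club. A continuous map $f\colon X\to Y$ is d-open if $f(U)\subset\operatorname{int}_Y\operatorname{cl}_Yf(U)$ for every open $U\subset X$. An inverse system $\{X_\sigma,\pi^\sigma_\varrho,\Gamma\}$ over a directed set $\Gamma$ is $\sigma$-complete if every increasing countable chain $\sigma_1\le\sigma_2\le\cdots$ in $\Gamma$ has a supremum $\sigma$ in $\Gamma$ and $X_\sigma$ is (via the bonding maps) the limit of the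 inverse sequence $\{X_{\sigma_n},\pi^{\sigma_{n+1}}_{\sigma_n}\}$. A space $X$ is an almost limit of an inverse system $S=\{X_\sigma,\pi^\sigma_\varrho,\Gamma\}$ if $X$ can be embedded in $\varprojlim S$ so that $\pi_\sigma(X)=X_\sigma$ for every $\sigma\in\Gamma$, where $\pi_\sigma$ are the limit projections. *)

theory Defs
  imports "HOL-Analysis.Analysis"
begin

definition sub_bang :: "'a topology \<Rightarrow> 'a set set \<Rightarrow> 'a set set \<Rightarrow> bool" where
  "sub_bang X P Q \<longleftrightarrow> P \<subseteq> Q \<and>
     (\<forall>S. S \<subseteq> P \<longrightarrow> (\<forall>x \<in> topspace X. x \<notin> X closure_of (\<Union>S) \<longrightarrow>
        (\<exists>W \<in> P. x \<in> W \<and> W \<inter> \<Union>S = {})))"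

definition countable_subfamilies :: "'b set \<Rightarrow> 'b set set" where
  "countable_subfamilies Q = {P. P \<subseteq> Q \<and> countable P}"

definition is_club :: "'b set \<Rightarrow> 'b set set \<Rightarrow> bool" where
  "is_club Q C \<longleftrightarrow> C \<subseteq> countable_subfamilies Q \<and>
     (\<forall>c :: nat \<Rightarrow> 'b set. (\<forall>n. c n \<in> C) \<and> (\<forall>n. c n \<subseteq> c (Suc n)) \<longrightarrow> (\<Union>n. c n) \<in> C) \<and>
     (\<forall>B \<in> countable_subfamilies Q. \<exists>D \<in> C. B \<subseteq> D)"

definition very_I_favorable :: "'a topology \<Rightarrow> bool" where
  "very_I_favorable X \<longleftrightarrow>
     (\<exists>C. is_club {U. openin X U} C \<and>
          C \<subseteq> {P \<in> countable_subfamilies {U. openin X U}. sub_bang X P {U. openin X U}})"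

definition d_open_map :: "'a topology \<Rightarrow> 'b topology \<Rightarrow> ('a \<Rightarrow> 'b) \<Rightarrow> bool" where
  "d_open_map X Y f \<longleftrightarrow> continuous_map X Y f \<and>
     (\<forall>U. openin X U \<longrightarrow> f ` U \<subseteq> Y interior_of (Y closure_of (f ` U)))"

definition inverse_system ::
  "'i set \<Rightarrow> ('i \<Rightarrow> 'i \<Rightarrow> bool) \<Rightarrow> ('i \<Rightarrow> 'b topology) \<Rightarrow> ('i \<Rightarrow> 'i \<Rightarrow> 'b \<Rightarrow> 'b) \<Rightarrow> bool" where
  "inverse_system \<Gamma> le Xs q \<longleftrightarrow>
     (\<forall>\<sigma> \<in> \<Gamma>. le \<sigma> \<sigma>) \<and>
     (\<forall>\<sigma> \<in> \<Gamma>. \<forall>\<rho> \<in> \<Gamma>. \<forall>\<tau> \<in> \<Gamma>. le \<tau> \<rho> \<and> le \<rho> \<sigma> \<longrightarrow> le \<tau> \<sigma>) \<and>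
     (\<forall>\<sigma> \<in> \<Gamma>. \<forall>\<rho> \<in> \<Gamma>. \<exists>\<tau> \<in> \<Gamma>. le \<sigma> \<tau> \<and> le \<rho> \<tau>) \<and>
     (\<forall>\<sigma> \<in> \<Gamma>. \<forall>\<rho> \<in> \<Gamma>. le \<rho> \<sigma> \<longrightarrow> continuous_map (Xs \<sigma>) (Xs \<rho>) (q \<sigma> \<rho>)) \<and>
     (\<forall>\<sigma> \<in> \<Gamma>. \<forall>x \<in> topspace (Xs \<sigma>). q \<sigma> \<sigma> x = x) \<and>
     (\<forall>\<sigma> \<in> \<Gamma>. \<forall>\<rho> \<in> \<Gamma>. \<forall>\<tau> \<in> \<Gamma>. le \<tau> \<rho> \<and> le \<rho> \<sigma> \<longrightarrow>
        (\<forall>x \<in> topspace (Xs \<sigma>). q \<rho> \<tau> (q \<sigma> \<rho> x) = q \<sigma> \<tau> x))"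

definition inv_limit ::
  "'i set \<Rightarrow> ('i \<Rightarrow> 'i \<Rightarrow> bool) \<Rightarrow> ('i \<Rightarrow> 'b topology) \<Rightarrow> ('i \<Rightarrow> 'i \<Rightarrow> 'b \<Rightarrow> 'b) \<Rightarrow> ('i \<Rightarrow> 'b) topology" where
  "inv_limit \<Gamma> le Xs q = subtopology (product_topology Xs \<Gamma>)
     {x \<in> topspace (product_topology Xs \<Gamma>). \<forall>\<sigma> \<in> \<Gamma>. \<forall>\<rho> \<in> \<Gamma>. le \<rho> \<sigma> \<longrightarrow> q \<sigma> \<rho> (x \<sigma>) = x \<rho>}"

definition inv_seq_limit ::
  "(nat \<Rightarrow> 'i) \<Rightarrow> ('i \<Rightarrow> 'b topology) \<Rightarrow> ('i \<Rightarrow> 'i \<Rightarrow> 'b \<Rightarrow> 'b) \<Rightarrow> (nat \<Rightarrow> 'b) topology" where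
  "inv_seq_limit s Xs q = subtopology (product_topology (\<lambda>n. Xs (s n)) UNIV)
     {y \<in> topspace (product_topology (\<lambda>n. Xs (s n)) UNIV). \<forall>n. q (s (Suc n)) (s n) (y (Suc n)) = y n}"

definition sigma_complete ::
  "'i set \<Rightarrow> ('i \<Rightarrow> 'i \<Rightarrow> bool) \<Rightarrow> ('i \<Rightarrow> 'b topology) \<Rightarrow> ('i \<Rightarrow> 'i \<Rightarrow> 'b \<Rightarrow> 'b) \<Rightarrow> bool" where
  "sigma_complete \<Gamma> le Xs q \<longleftrightarrow>
     (\<forall>s :: nat \<Rightarrow> 'i. (\<forall>n. s n \<in> \<Gamma>) \<and> (\<forall>n. le (s n) (s (Suc n))) \<longrightarrow>
        (\<exists>\<sigma> \<in> \<Gamma>. (\<forall>n. le (s n) \<sigma>) \<and>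
                 (\<forall>\<tau> \<in> \<Gamma>. (\<forall>n. le (s n) \<tau>) \<longrightarrow> le \<sigma> \<tau>) \<and>
                 homeomorphic_map (Xs \<sigma>) (inv_seq_limit s Xs q) (\<lambda>x n. q \<sigma> (s n) x)))"

definition almost_limit ::
  "'a topology \<Rightarrow> 'i set \<Rightarrow> ('i \<Rightarrow> 'i \<Rightarrow> bool) \<Rightarrow> ('i \<Rightarrow> 'b topology) \<Rightarrow> ('i \<Rightarrow> 'i \<Rightarrow> 'b \<Rightarrow> 'b) \<Rightarrow> bool" where
  "almost_limit X \<Gamma> le Xs q \<longleftrightarrow>
     (\<exists>e. embedding_map X (inv_limit \<Gamma> le Xs q) e \<and>
          (\<forall>\<sigma> \<in> \<Gamma>. (\<lambda>x. e x \<sigma>) ` topspace X = topspace (Xs \<sigma>)))"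

definition good_system ::
  "'a topology \<Rightarrow> 'i set \<Rightarrow> ('i \<Rightarrow> 'i \<Rightarrow> bool) \<Rightarrow> ('i \<Rightarrow> 'b topology) \<Rightarrow> ('i \<Rightarrow> 'i \<Rightarrow> 'b \<Rightarrow> 'b) \<Rightarrow> bool" where
  "good_system X \<Gamma> le Xs q \<longleftrightarrow>
     inverse_system \<Gamma> le Xs q \<and> sigma_complete \<Gamma> le Xs q \<and>
     (\<forall>\<sigma> \<in> \<Gamma>. second_countable (Xs \<sigma>)) \<and>
     (\<forall>\<sigma> \<in> \<Gamma>. \<forall>\<rho> \<in> \<Gamma>. le \<rho> \<sigma> \<longrightarrow>
        d_open_map (Xs \<sigma>) (Xs \<rho>) (q \<sigma> \<rho>) \<and> q \<sigma> \<rho> ` topspace (Xs \<sigma>) = topspace (Xs \<rho>)) \<and>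
     almost_limit X \<Gamma> le Xs q"

end

theory Submission
  imports Defs
begin

text \<open>
  Pulling the topologies of the spaces \<open>X\<^sub>\<sigma>\<close> back to \<open>X\<close> turns the system into a directed family of
  second countable topologies \<open>T\<^sub>\<sigma>\<close> on \<open>X\<close>, where d-openness says that every open \<open>U\<close> lies in the
  \<open>T\<^sub>\<sigma>\<close>-interior of its \<open>T\<^sub>\<sigma>\<close>-closure. Completeness gives, for each open \<open>U\<close>, an index \<open>\<sigma>\<close> such that
  some \<open>T\<^sub>\<sigma>\<close>-open subset of \<open>U\<close> is dense in \<open>U\<close>. Assign monotonically to each finite family \<open>F\<close> of
  open sets an index \<open>\<phi> F\<close> working for all members of \<open>F\<close>; the countable families closed under adding
  a countable base of \<open>T\<^bsub>\<phi> F\<^esub>\<close> for their finite subfamilies \<open>F\<close> then form the required club.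

  Conversely, the members of a club that are closed under binary intersections generate such a family
  of topologies, indexed by inclusion.
\<close>

section \<open>Auxiliary facts on favorability, increasing chains and d-open maps\<close>

text \<open>This settles the degenerate case of an empty index set. A countable topology is itself a
  countable family of open sets, and the class with this family as sole member is a club; the
  complement of the closure is an admissible \<open>W\<close>.\<close>

lemma countable_opens_imp_very_I_favorable:
  assumes "countable {U. openin X U}"
  shows "very_I_favorable X"
proof -
  have "sub_bang X {U. openin X U} {U. openin X U}"
    unfolding sub_bang_def
  proof (intro conjI allI impI ballI subset_refl)
    fix S x
    assume S: "S \<subseteq> {U. openin X U}" and x: "x \<in> topspace X" "x \<notin> X closure_of \<Union>S"
    have "\<Union>S \<subseteq> X closure_of \<Union>S"
      using S by (intro closure_of_subset) (auto dest: openin_subset)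
    then show "\<exists>W\<in>{U. openin X U}. x \<in> W \<and> W \<inter> \<Union>S = {}"
      using x by (intro bexI[of _ "topspace X - X closure_of \<Union>S"]) (auto simp: openin_diff)
  qed
  moreover have "is_club {U. openin X U} {{U. openin X U}}"
    using assms by (auto simp: is_club_def countable_subfamilies_def)
  ultimately show ?thesis
    using assms unfolding very_I_favorable_def countable_subfamilies_def by fastforce
qed

lemma finite_subset_Union_chain_nat:
  fixes c :: "nat \<Rightarrow> 'a set"
  assumes "finite F" "F \<subseteq> (\<Union>n. c n)" "\<forall>n. c n \<subseteq> c (Suc n)"
  shows "\<exists>n. F \<subseteq> c n"
  using assms(1,2)
proof (induction F)
  case (insert x F)
  then obtain m n where "x \<in> c m" "F \<subseteq> c n" by blast
  moreover have "c m \<subseteq> c (max m n)" "c n \<subseteq> c (max m n)"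
    using assms(3) by (simp_all add: lift_Suc_mono_le)
  ultimately show ?case by blast
qed simp

lemma d_open_mapI:
  assumes "continuous_map X Y f"
    and "\<And>U x. openin X U \<Longrightarrow> x \<in> U \<Longrightarrow> \<exists>W. openin Y W \<and> f x \<in> W \<and> W \<subseteq> Y closure_of (f ` U)"
  shows "d_open_map X Y f"
  unfolding d_open_map_def interior_of_def using assms by blast

lemma d_open_mapD:
  assumes "d_open_map X Y f" "openin X U" "x \<in> U"
  obtains W where "openin Y W" "f x \<in> W" "W \<subseteq> Y closure_of (f ` U)"
  using assms unfolding d_open_map_def interior_of_def by blast

subsection \<open>Embeddings into products\<close>

lemma openin_product_topology_local:
  assumes "openin (product_topology Y I) W" "z \<in> W"
  obtains K U where "finite K" "K \<subseteq> I" "\<And>i. i \<in> K \<Longrightarrow> openin (Y i) (U i)" "\<And>i. i \<in> K \<Longrightarrow> z i \<in> U i"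
    "\<And>w. w \<in> topspace (product_topology Y I) \<Longrightarrow> (\<And>i. i \<in> K \<Longrightarrow> w i \<in> U i) \<Longrightarrow> w \<in> W"
proof -
  obtain U where U: "finite {i \<in> I. U i \<noteq> topspace (Y i)}" "\<forall>i\<in>I. openin (Y i) (U i)"
      "z \<in> Pi\<^sub>E I U" "Pi\<^sub>E I U \<subseteq> W"
    using assms unfolding openin_product_topology_alt by metis
  show thesis
  proof (rule that[of "{i \<in> I. U i \<noteq> topspace (Y i)}" U])
    fix w
    assume w: "w \<in> topspace (product_topology Y I)"
      and wU: "\<And>i. i \<in> {i \<in> I. U i \<noteq> topspace (Y i)} \<Longrightarrow> w i \<in> U i"
    have "w \<in> Pi\<^sub>E I U"
    proof (rule PiE_I)
      fix i assume "i \<in> I" then show "w i \<in> U i"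
        using w wU by (cases "U i = topspace (Y i)") (auto simp: PiE_iff)
    next
      fix i assume "i \<notin> I" then show "w i = undefined"
        using w by (auto simp: PiE_iff extensional_def)
    qed
    then show "w \<in> W" using U(4) by blast
  qed (use U in \<open>auto simp: PiE_iff\<close>)
qed

text \<open>One injective \<open>f\<close> gives every coordinate, which covers two uses: the
  identity into the product over a chain, and \<open>\<lambda>x. {x}\<close> into the product over
  all indices. Openness is tested in a single coordinate: \<open>base\<close> puts an open
  \<open>V\<close> inside the image of \<open>U\<close>, and by injectivity every point of
  \<open>Z\<close> that \<open>f\<close> sends into \<open>V\<close> lies in
  \<open>U\<close>.\<close>

lemma diagonal_embedding:
  assumes cont: "\<And>i. i \<in> I \<Longrightarrow> continuous_map Z (Y i) f"
    and inj: "inj_on f (topspace Z)"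
    and surj: "\<And>i. i \<in> I \<Longrightarrow> topspace (Y i) = f ` topspace Z"
    and "I \<noteq> {}"
    and base: "\<And>U x. openin Z U \<Longrightarrow> x \<in> U \<Longrightarrow> \<exists>i\<in>I. \<exists>V. openin (Y i) V \<and> f x \<in> V \<and> V \<subseteq> f ` U"
  shows "embedding_map Z (product_topology Y I) (\<lambda>x. \<lambda>i\<in>I. f x)"
proof -
  define e where "e = (\<lambda>x. \<lambda>i\<in>I. f x)"
  have e_inj: "f x = f y" if "e x = e y" for x y
    using that \<open>I \<noteq> {}\<close> unfolding e_def by (metis equals0I restrict_apply')
  have "open_map Z (subtopology (product_topology Y I) (e ` topspace Z)) e"
    unfolding open_map_def
  proof (intro allI impI, subst openin_subopen, intro ballI)
    fix U y assume U: "openin Z U" and "y \<in> e ` U"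
    then obtain x where x: "x \<in> U" "y = e x" by blast
    obtain i V where V: "i \<in> I" "openin (Y i) V" "f x \<in> V" "V \<subseteq> f ` U"
      using base[OF U x(1)] by blast
    define W where "W = {w \<in> topspace (product_topology Y I). w i \<in> V} \<inter> e ` topspace Z"
    have "openin (subtopology (product_topology Y I) (e ` topspace Z)) W"
      unfolding W_def openin_subtopology
      using openin_continuous_map_preimage[OF continuous_map_product_projection[of i I Y, OF V(1)] V(2)] by blast
    moreover have "y \<in> W"
      using x V openin_subset[OF U] surj by (auto simp: W_def e_def PiE_iff)
    moreover have "W \<subseteq> e ` U"
    proof
      fix w assume "w \<in> W"
      then obtain z where z: "z \<in> topspace Z" "w = e z" "f z \<in> V"
        using V(1) by (auto simp: W_def e_def)
      then obtain u where "u \<in> U" "f z = f u" using V(4) by blast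
      then have "z = u" using inj z(1) openin_subset[OF U] by (meson inj_onD subsetD)
      then show "w \<in> e ` U" using z \<open>u \<in> U\<close> by blast
    qed
    ultimately show "\<exists>T. openin (subtopology (product_topology Y I) (e ` topspace Z)) T \<and> y \<in> T \<and> T \<subseteq> e ` U"
      by blast
  qed
  moreover have cont_e: "continuous_map Z (product_topology Y I) e"
    unfolding e_def continuous_map_componentwise using cont by auto
  moreover have "inj_on e (topspace Z)"
    using e_inj inj unfolding inj_on_def by blast
  moreover have "topspace (subtopology (product_topology Y I) (e ` topspace Z)) = e ` topspace Z"
    using continuous_map_image_subset_topspace[OF cont_e] by (simp only: topspace_subtopology Int_absorb1)
  ultimately have "embedding_map Z (product_topology Y I) e"
    unfolding embedding_map_def
    by (intro bijective_open_imp_homeomorphic_map) (simp_all add: continuous_map_in_subtopology)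
  then show ?thesis by (simp add: e_def)
qed


lemma embedding_imp_continuous_map:
  "embedding_map X Y f \<Longrightarrow> continuous_map X Y f"
  unfolding embedding_map_def
  using continuous_map_in_subtopology homeomorphic_imp_continuous_map by blast

text \<open>The image of \<open>U\<close> is the trace of an open set of the product; a box around
  \<open>e x\<close> fits into that set, and injectivity of \<open>e\<close> carries the coordinate
  conditions back to \<open>U\<close>. It serves both for \<open>X\<close> in the product over all
  indices and for the space at the supremum of a chain in the product over that chain.\<close>

lemma embedding_product_base:
  assumes e: "embedding_map Z (product_topology Y I) e" and U: "openin Z U" "x \<in> U"
  obtains K V where "finite K" "K \<subseteq> I" "\<forall>i\<in>K. openin (Y i) (V i)" "\<forall>i\<in>K. e x i \<in> V i"
    "\<forall>y\<in>topspace Z. (\<forall>i\<in>K. e y i \<in> V i) \<longrightarrow> y \<in> U"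
proof -
  have hom: "homeomorphic_map Z (subtopology (product_topology Y I) (e ` topspace Z)) e"
    using e by (simp add: embedding_map_def)
  then have "openin (subtopology (product_topology Y I) (e ` topspace Z)) (e ` U)"
    using U(1) homeomorphic_imp_open_map unfolding open_map_def by blast
  then obtain W where W: "openin (product_topology Y I) W" "e ` U = W \<inter> e ` topspace Z"
    unfolding openin_subtopology by blast
  have "e x \<in> W" using W(2) U(2) by blast
  from openin_product_topology_local[OF W(1) this] obtain K V where K: "finite K" "K \<subseteq> I"
      "\<forall>i\<in>K. openin (Y i) (V i)" "\<forall>i\<in>K. e x i \<in> V i"
      "\<forall>w\<in>topspace (product_topology Y I). (\<forall>i\<in>K. w i \<in> V i) \<longrightarrow> w \<in> W"
    by (metis (no_types, lifting))
  have "y \<in> U" if y: "y \<in> topspace Z" "\<forall>i\<in>K. e y i \<in> V i" for y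
  proof -
    have "e y \<in> topspace (product_topology Y I)"
      using e y(1) continuous_map_image_subset_topspace[OF embedding_imp_continuous_map[OF e]] by blast
    then have "e y \<in> W" using K(5) y(2) by blast
    then have "e y \<in> e ` U" using W(2) y(1) by blast
    moreover have "inj_on e (topspace Z)" using homeomorphic_imp_injective_map[OF hom] .
    ultimately show ?thesis
      using y(1) openin_subset[OF U(1)] by (simp add: inj_on_image_mem_iff)
  qed
  with K show thesis by (intro that[of K V]) auto
qed

subsection \<open>Directed systems of topologies\<close>

text \<open>All spaces share the point set of \<open>X\<close>, so the bonding maps are identities
  and \<open>d_open\<close> says that these are d-open. \<open>base_X\<close> stands for the
  embedding into the limit. The last clause of \<open>sup_chain\<close> stands for the limit
  condition: the topologies along the chain form a base of the topology at the supremum.\<close>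

locale topology_system =
  fixes X :: "'a topology" and \<Gamma> :: "'i set" and le :: "'i \<Rightarrow> 'i \<Rightarrow> bool" and T :: "'i \<Rightarrow> 'a topology"
  assumes nonempty: "\<Gamma> \<noteq> {}"
    and le_refl: "\<sigma> \<in> \<Gamma> \<Longrightarrow> le \<sigma> \<sigma>"
    and le_trans: "\<lbrakk>\<sigma> \<in> \<Gamma>; \<rho> \<in> \<Gamma>; \<tau> \<in> \<Gamma>; le \<tau> \<rho>; le \<rho> \<sigma>\<rbrakk> \<Longrightarrow> le \<tau> \<sigma>"
    and directed: "\<lbrakk>\<sigma> \<in> \<Gamma>; \<rho> \<in> \<Gamma>\<rbrakk> \<Longrightarrow> \<exists>\<tau>\<in>\<Gamma>. le \<sigma> \<tau> \<and> le \<rho> \<tau>"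
    and topspace_T: "\<sigma> \<in> \<Gamma> \<Longrightarrow> topspace (T \<sigma>) = topspace X"
    and second_countable_T: "\<sigma> \<in> \<Gamma> \<Longrightarrow> second_countable (T \<sigma>)"
    and openin_mono: "\<lbrakk>\<sigma> \<in> \<Gamma>; \<rho> \<in> \<Gamma>; le \<rho> \<sigma>; openin (T \<rho>) U\<rbrakk> \<Longrightarrow> openin (T \<sigma>) U"
    and openin_X: "\<lbrakk>\<sigma> \<in> \<Gamma>; openin (T \<sigma>) U\<rbrakk> \<Longrightarrow> openin X U"
    and base_X: "\<lbrakk>openin X U; x \<in> U\<rbrakk> \<Longrightarrow> \<exists>\<sigma>\<in>\<Gamma>. \<exists>V. openin (T \<sigma>) V \<and> x \<in> V \<and> V \<subseteq> U"
    and sup_chain: "\<lbrakk>\<And>n. s n \<in> \<Gamma>; \<And>n. le (s n) (s (Suc n))\<rbrakk> \<Longrightarrow>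
      \<exists>\<sigma>\<in>\<Gamma>. (\<forall>n. le (s n) \<sigma>) \<and> (\<forall>\<tau>\<in>\<Gamma>. (\<forall>n. le (s n) \<tau>) \<longrightarrow> le \<sigma> \<tau>) \<and>
        (\<forall>U x. openin (T \<sigma>) U \<longrightarrow> x \<in> U \<longrightarrow> (\<exists>n V. openin (T (s n)) V \<and> x \<in> V \<and> V \<subseteq> U))"
    and d_open: "\<lbrakk>\<sigma> \<in> \<Gamma>; \<rho> \<in> \<Gamma>; le \<rho> \<sigma>; openin (T \<sigma>) U; x \<in> U\<rbrakk> \<Longrightarrow>
      \<exists>W. openin (T \<rho>) W \<and> x \<in> W \<and> W \<subseteq> T \<rho> closure_of U"
begin

lemma sup_chainE:
  assumes "\<forall>n. s n \<in> \<Gamma>" "\<forall>n. le (s n) (s (Suc n))"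
  obtains \<sigma> where "\<sigma> \<in> \<Gamma>" "\<forall>n. le (s n) \<sigma>"
    "\<forall>V x. openin (T \<sigma>) V \<longrightarrow> x \<in> V \<longrightarrow> (\<exists>n W. openin (T (s n)) W \<and> x \<in> W \<and> W \<subseteq> V)"
proof -
  have "\<And>n. s n \<in> \<Gamma>" "\<And>n. le (s n) (s (Suc n))" using assms by auto
  from sup_chain[of s, OF this] that show thesis by (elim bexE conjE) iprover
qed

text \<open>Along an enumeration of \<open>K\<close>, directedness gives an increasing sequence
  whose n-th term lies above the n-th element; its supremum bounds \<open>K\<close>.\<close>

lemma countable_upper_bound:
  assumes "countable K" "K \<subseteq> \<Gamma>"
  shows "\<exists>\<sigma>\<in>\<Gamma>. \<forall>\<kappa>\<in>K. le \<kappa> \<sigma>"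
proof (cases "K = {}")
  case True
  then show ?thesis using nonempty by blast
next
  case False
  define k where "k = from_nat_into K"
  have k: "k n \<in> \<Gamma>" "range k = K" for n
    using assms False by (auto simp: k_def range_from_nat_into from_nat_into subset_iff)
  have "\<exists>s. \<forall>n. (s n \<in> \<Gamma> \<and> le (k n) (s n)) \<and> le (s n) (s (Suc n))"
  proof (rule dependent_nat_choice)
    show "\<exists>x. x \<in> \<Gamma> \<and> le (k 0) x" using k le_refl by blast
    show "\<exists>y. (y \<in> \<Gamma> \<and> le (k (Suc n)) y) \<and> le x y" if "x \<in> \<Gamma> \<and> le (k n) x" for x n
      using directed[of x "k (Suc n)"] k(1) that by blast
  qed
  then obtain s where s: "\<And>n. s n \<in> \<Gamma>" "\<And>n. le (k n) (s n)" "\<And>n. le (s n) (s (Suc n))" by blast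
  obtain \<sigma> where \<sigma>: "\<sigma> \<in> \<Gamma>" "\<forall>n. le (s n) \<sigma>"
    by (rule sup_chainE[of s, OF allI[OF s(1)] allI[OF s(3)]]) (rule that)
  then have "le (k n) \<sigma>" for n using le_trans k s by meson
  then show ?thesis using \<sigma>(1) k(2) by blast
qed

text \<open>The identity from \<open>X\<close> itself to \<open>T \<sigma>\<close> is d-open as
  well: around \<open>x\<close>, shrink \<open>U\<close> to a set open in some
  \<open>T \<tau>\<close>, and apply \<open>d_open\<close> between \<open>\<sigma>\<close> and a
  common upper bound of \<open>\<sigma>\<close> and \<open>\<tau>\<close>.\<close>

lemma d_open_X:
  assumes "\<sigma> \<in> \<Gamma>" "openin X U" "x \<in> U"
  shows "\<exists>W. openin (T \<sigma>) W \<and> x \<in> W \<and> W \<subseteq> T \<sigma> closure_of U"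
proof -
  obtain \<tau> V where V: "\<tau> \<in> \<Gamma>" "openin (T \<tau>) V" "x \<in> V" "V \<subseteq> U"
    using base_X[OF assms(2,3)] by blast
  obtain \<upsilon> where \<upsilon>: "\<upsilon> \<in> \<Gamma>" "le \<sigma> \<upsilon>" "le \<tau> \<upsilon>"
    using directed[OF assms(1) V(1)] by blast
  obtain W where "openin (T \<sigma>) W" "x \<in> W" "W \<subseteq> T \<sigma> closure_of V"
    using d_open[OF \<upsilon>(1) assms(1) \<upsilon>(2) openin_mono[OF \<upsilon>(1) V(1) \<upsilon>(3) V(2)] V(3)] by blast
  then show ?thesis using closure_of_mono[OF V(4)] by blast
qed

text \<open>Such a \<open>V\<close> has the same closure in \<open>X\<close> as \<open>U\<close>, so
  where only closures matter \<open>U\<close> can be traded for a \<open>T \<sigma>\<close>-open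
  set.\<close>

definition determines :: "'i \<Rightarrow> 'a set \<Rightarrow> bool" where
  "determines \<sigma> U \<longleftrightarrow> (\<exists>V. openin (T \<sigma>) V \<and> V \<subseteq> U \<and> U \<subseteq> X closure_of V)"

lemma determines_mono: "\<lbrakk>\<sigma> \<in> \<Gamma>; \<rho> \<in> \<Gamma>; le \<rho> \<sigma>; determines \<rho> U\<rbrakk> \<Longrightarrow> determines \<sigma> U"
  unfolding determines_def using openin_mono by blast

text \<open>
  Close an index off under choosing, inside every basic open set that meets \<open>U\<close>, a nonempty open subset
  of \<open>U\<close>. By d-openness the open subsets of \<open>U\<close> seen at the supremum are then dense in \<open>U\<close>.
\<close>

lemma ex_determines:
  assumes U: "openin X U"
  shows "\<exists>\<sigma>\<in>\<Gamma>. determines \<sigma> U"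
proof -
  define good where "good = (\<lambda>\<sigma> \<tau>. \<forall>V. openin (T \<sigma>) V \<and> V \<inter> U \<noteq> {} \<longrightarrow>
    (\<exists>G. openin (T \<tau>) G \<and> G \<noteq> {} \<and> G \<subseteq> V \<inter> U))"
  have step: "\<exists>\<tau>\<in>\<Gamma>. le \<sigma> \<tau> \<and> good \<sigma> \<tau>" if \<sigma>: "\<sigma> \<in> \<Gamma>" for \<sigma>
  proof -
    obtain B where B: "countable B" "\<And>V. V \<in> B \<Longrightarrow> openin (T \<sigma>) V"
        "\<And>V x. openin (T \<sigma>) V \<Longrightarrow> x \<in> V \<Longrightarrow> \<exists>W\<in>B. x \<in> W \<and> W \<subseteq> V"
      using second_countable_T[OF \<sigma>] unfolding second_countable_def by metis
    \<comment> \<open>The upper bound below is taken over all of \<open>B\<close>, so an index in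
      \<open>\<Gamma>\<close> is needed even if \<open>V\<close> misses \<open>U\<close>; then
      \<open>\<sigma>\<close> is the default.\<close>
    have ex: "\<exists>\<tau>. \<tau> \<in> \<Gamma> \<and> (V \<inter> U \<noteq> {} \<longrightarrow> (\<exists>G. openin (T \<tau>) G \<and> G \<noteq> {} \<and> G \<subseteq> V \<inter> U))" if "V \<in> B" for V
    proof (cases "V \<inter> U = {}")
      case True
      then show ?thesis using \<sigma> by auto
    next
      case False
      then obtain x where x: "x \<in> V \<inter> U" by blast
      have "openin X (V \<inter> U)" using openin_X[OF \<sigma> B(2)[OF that]] U by blast
      from base_X[OF this x] show ?thesis using x by blast
    qed
    from bchoice[OF ballI[OF ex]] obtain t where "\<forall>V\<in>B. t V \<in> \<Gamma> \<and>
        (V \<inter> U \<noteq> {} \<longrightarrow> (\<exists>G. openin (T (t V)) G \<and> G \<noteq> {} \<and> G \<subseteq> V \<inter> U))" ..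
    then have t: "\<And>V. V \<in> B \<Longrightarrow> t V \<in> \<Gamma>"
        "\<And>V. V \<in> B \<Longrightarrow> V \<inter> U \<noteq> {} \<Longrightarrow> \<exists>G. openin (T (t V)) G \<and> G \<noteq> {} \<and> G \<subseteq> V \<inter> U"
      by simp_all
    obtain \<tau> where \<tau>: "\<tau> \<in> \<Gamma>" "\<And>\<kappa>. \<kappa> \<in> insert \<sigma> (t ` B) \<Longrightarrow> le \<kappa> \<tau>"
      using countable_upper_bound[of "insert \<sigma> (t ` B)"] B(1) t(1) \<sigma> by blast
    have "good \<sigma> \<tau>"
      unfolding good_def
    proof (intro allI impI, elim conjE)
      fix V assume V: "openin (T \<sigma>) V" "V \<inter> U \<noteq> {}"
      then obtain x where x: "x \<in> V" "x \<in> U" by blast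
      obtain W where W: "W \<in> B" "x \<in> W" "W \<subseteq> V" using B(3)[OF V(1) x(1)] by blast
      obtain G where "openin (T (t W)) G" "G \<noteq> {}" "G \<subseteq> W \<inter> U"
        using t(2)[OF W(1)] W x by blast
      then show "\<exists>G. openin (T \<tau>) G \<and> G \<noteq> {} \<and> G \<subseteq> V \<inter> U"
        using openin_mono[OF \<tau>(1) t(1)[OF W(1)]] \<tau>(2) W by blast
    qed
    then show ?thesis using \<tau> by blast
  qed
  have "\<exists>s. \<forall>n. s n \<in> \<Gamma> \<and> (le (s n) (s (Suc n)) \<and> good (s n) (s (Suc n)))"
    using nonempty step by (intro dependent_nat_choice) auto
  then obtain s where s: "\<And>n. s n \<in> \<Gamma>" "\<And>n. le (s n) (s (Suc n))" "\<And>n. good (s n) (s (Suc n))"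
    by blast
  obtain \<sigma> where \<sigma>': "\<sigma> \<in> \<Gamma>" "\<forall>n. le (s n) \<sigma>"
      "\<forall>V x. openin (T \<sigma>) V \<longrightarrow> x \<in> V \<longrightarrow> (\<exists>n W. openin (T (s n)) W \<and> x \<in> W \<and> W \<subseteq> V)"
    by (rule sup_chainE[of s, OF allI[OF s(1)] allI[OF s(2)]]) (rule that)
  note \<sigma> = \<sigma>'(1) \<sigma>'(2,3)[rule_format]
  \<comment> \<open>The interior of \<open>U\<close> in \<open>T \<sigma>\<close>, which absorbs
    every \<open>T \<sigma>\<close>-open subset of \<open>U\<close> found along the chain.\<close>
  define V where "V = \<Union>{G. openin (T \<sigma>) G \<and> G \<subseteq> U}"
  have V: "openin (T \<sigma>) V" "V \<subseteq> U" by (auto simp: V_def)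
  have clV: "V \<subseteq> X closure_of V"
    using openin_X[OF \<sigma>(1) V(1)] by (simp add: closure_of_subset openin_subset)
  have "U \<subseteq> X closure_of V"
  proof (rule ccontr)
    assume "\<not> U \<subseteq> X closure_of V"
    then obtain x where x: "x \<in> U - X closure_of V" by blast
    have "openin X (U - X closure_of V)" using U by (simp add: openin_diff)
    \<comment> \<open>d-openness is applied to the part of \<open>U\<close> not covered by the
      closure of \<open>V\<close>. Stage \<open>n\<close> supplies a basic \<open>W'\<close> inside
      \<open>W\<close>, and stage \<open>Suc n\<close> a nonempty \<open>G\<close> inside
      \<open>W'\<close> and \<open>U\<close>. This \<open>G\<close> is part of \<open>V\<close>, yet
      lies in the \<open>T \<sigma>\<close>-closure of the uncovered part and so meets it, a
      contradiction.\<close>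
    then obtain W where W: "openin (T \<sigma>) W" "x \<in> W" "W \<subseteq> T \<sigma> closure_of (U - X closure_of V)"
      using d_open_X[OF \<sigma>(1) _ x] by blast
    obtain n W' where W': "openin (T (s n)) W'" "x \<in> W'" "W' \<subseteq> W"
      using \<sigma>(3)[OF W(1,2)] by blast
    obtain G where G: "openin (T (s (Suc n))) G" "G \<noteq> {}" "G \<subseteq> W' \<inter> U"
      using s(3)[of n] W' x unfolding good_def by blast
    have G\<sigma>: "openin (T \<sigma>) G" using openin_mono[OF \<sigma>(1) s(1) \<sigma>(2) G(1)] .
    then have "G \<subseteq> V" using G(3) by (auto simp: V_def)
    obtain y where "y \<in> G" using G(2) by blast
    then have "y \<in> T \<sigma> closure_of (U - X closure_of V)" using G W W' by blast
    then obtain z where "z \<in> U - X closure_of V" "z \<in> G"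
      using G\<sigma> \<open>y \<in> G\<close> unfolding in_closure_of by blast
    then show False using \<open>G \<subseteq> V\<close> clV by blast
  qed
  then show ?thesis unfolding determines_def using \<sigma>(1) V by blast
qed

section \<open>Monotone choice of indices and the resulting club\<close>

text \<open>Recursion over finite families: \<open>\<phi> F\<close> is an upper bound of the values
  at the finitely many proper subsets of \<open>F\<close> and of one determining index for each
  member. Monotonicity is what turns an increasing exhaustion by finite families into a chain of
  indices.\<close>

lemma ex_monotone_determining_index:
  obtains \<phi> where "\<And>F. \<lbrakk>finite F; F \<subseteq> {U. openin X U}\<rbrakk> \<Longrightarrow> \<phi> F \<in> \<Gamma>"
    "\<And>F U. \<lbrakk>finite F; F \<subseteq> {U. openin X U}; U \<in> F\<rbrakk> \<Longrightarrow> determines (\<phi> F) U"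
    "\<And>F F'. \<lbrakk>finite F; F \<subseteq> {U. openin X U}; F' \<subseteq> F\<rbrakk> \<Longrightarrow> le (\<phi> F') (\<phi> F)"
proof -
  let ?O = "{U. openin X U}"
  \<comment> \<open>The recursion must supply a value for every \<open>F\<close>, so the condition
    is void unless \<open>F\<close> is a finite family of open sets. It consults \<open>f\<close> at
    proper subsets only, as well-foundedness demands; the case of equal sets is left to reflexivity
    of \<open>le\<close>.\<close>
  let ?P = "\<lambda>f F r. finite F \<and> F \<subseteq> ?O \<longrightarrow> r \<in> \<Gamma> \<and> (\<forall>U\<in>F. determines r U) \<and> (\<forall>F'. F' \<subset> F \<longrightarrow> le (f F') r)"
  obtain d where d: "\<And>U. openin X U \<Longrightarrow> d U \<in> \<Gamma>" "\<And>U. openin X U \<Longrightarrow> determines (d U) U"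
    using ex_determines by metis
  have "\<exists>\<phi>. \<forall>F. ?P \<phi> F (\<phi> F)"
  proof (rule dependent_wf_choice[OF wf_finite_psubset])
    fix f g :: "'a set set \<Rightarrow> 'i" and F r
    assume "\<And>z. (z, F) \<in> finite_psubset \<Longrightarrow> f z = g z"
    then show "?P f F r = ?P g F r" by (auto simp: finite_psubset_def)
  next
    fix F and f :: "'a set set \<Rightarrow> 'i"
    assume IH: "\<And>G. (G, F) \<in> finite_psubset \<Longrightarrow> ?P f G (f G)"
    show "\<exists>r. ?P f F r"
    proof (cases "finite F \<and> F \<subseteq> ?O")
      case True
      let ?K = "f ` {F'. F' \<subset> F} \<union> d ` F"
      have "finite {F'. F' \<subset> F}"
        using True by (auto intro: finite_subset[of _ "Pow F"])
      then have "countable ?K" using True by (simp add: countable_finite)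
      moreover have "?K \<subseteq> \<Gamma>"
      proof -
        have "f F' \<in> \<Gamma>" if "F' \<subset> F" for F'
        proof -
          have "finite F'" "F' \<subseteq> ?O" using that True finite_subset by blast+
          then show ?thesis using IH[of F'] that True by (simp add: finite_psubset_def)
        qed
        then show ?thesis using d True by blast
      qed
      ultimately obtain r where r: "r \<in> \<Gamma>" "\<forall>\<kappa>\<in>?K. le \<kappa> r"
        using countable_upper_bound[of ?K] by auto
      have "determines r U" if "U \<in> F" for U
        using determines_mono[OF r(1), of "d U" U] d[of U] that True r(2) by blast
      moreover have "le (f F') r" if "F' \<subset> F" for F'
        using r(2) that by blast
      ultimately show ?thesis using r(1) by (intro exI[of _ r]) simp
    qed blast
  qed
  then obtain \<phi> where \<phi>: "\<And>F. ?P \<phi> F (\<phi> F)" by blast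
  show thesis
  proof (rule that[of \<phi>])
    fix F F' assume F: "finite F" "F \<subseteq> ?O" "F' \<subseteq> F"
    show "le (\<phi> F') (\<phi> F)"
      using \<phi>[of F] F le_refl[of "\<phi> F"] by (cases "F' = F") (simp_all add: psubset_eq)
  qed (use \<phi> in simp_all)
qed

text \<open>Exhaust a member \<open>P\<close> of the club by finite families and let
  \<open>\<sigma>\<close> be the supremum of their indices. Then \<open>P\<close> contains a base of
  \<open>T \<sigma>\<close>, and \<open>\<sigma>\<close> determines every member of
  \<open>P\<close>; with d-openness this yields the separation demanded by
  \<open>sub_bang\<close>.\<close>

theorem very_I_favorable: "very_I_favorable X"
proof -
  let ?O = "{U. openin X U}"
  obtain \<phi> where \<phi>: "\<And>F. \<lbrakk>finite F; F \<subseteq> ?O\<rbrakk> \<Longrightarrow> \<phi> F \<in> \<Gamma>"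
    "\<And>F U. \<lbrakk>finite F; F \<subseteq> ?O; U \<in> F\<rbrakk> \<Longrightarrow> determines (\<phi> F) U"
    "\<And>F F'. \<lbrakk>finite F; F \<subseteq> ?O; F' \<subseteq> F\<rbrakk> \<Longrightarrow> le (\<phi> F') (\<phi> F)"
    using ex_monotone_determining_index by blast
  have "\<forall>\<sigma>. \<exists>B. \<sigma> \<in> \<Gamma> \<longrightarrow> countable B \<and> (\<forall>V\<in>B. openin (T \<sigma>) V) \<and>
      (\<forall>V x. openin (T \<sigma>) V \<and> x \<in> V \<longrightarrow> (\<exists>W\<in>B. x \<in> W \<and> W \<subseteq> V))"
    using second_countable_T unfolding second_countable_def by metis
  then obtain N where N: "\<And>\<sigma>. \<sigma> \<in> \<Gamma> \<Longrightarrow> countable (N \<sigma>)" "\<And>\<sigma> V. \<sigma> \<in> \<Gamma> \<Longrightarrow> V \<in> N \<sigma> \<Longrightarrow> openin (T \<sigma>) V"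
      "\<And>\<sigma> V x. \<sigma> \<in> \<Gamma> \<Longrightarrow> openin (T \<sigma>) V \<Longrightarrow> x \<in> V \<Longrightarrow> \<exists>W\<in>N \<sigma>. x \<in> W \<and> W \<subseteq> V"
    by metis
  \<comment> \<open>Only finite subfamilies enter this closure condition. It therefore passes to
    unions of increasing sequences, and can be reached from a countable family in countably many
    countable steps.\<close>
  define C where "C = {P \<in> countable_subfamilies ?O. \<forall>F. finite F \<longrightarrow> F \<subseteq> P \<longrightarrow> N (\<phi> F) \<subseteq> P}"
  have "is_club ?O C"
    unfolding is_club_def
  proof (intro conjI allI impI ballI)
    show "C \<subseteq> countable_subfamilies ?O" by (auto simp: C_def)
  next
    fix c :: "nat \<Rightarrow> 'a set set"
    assume c: "(\<forall>n. c n \<in> C) \<and> (\<forall>n. c n \<subseteq> c (Suc n))"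
    have "N (\<phi> F) \<subseteq> (\<Union>n. c n)" if F: "finite F" "F \<subseteq> (\<Union>n. c n)" for F
    proof -
      obtain n where n: "F \<subseteq> c n"
        using finite_subset_Union_chain_nat[OF F] c by auto
      have "c n \<in> C" using c by simp
      then have "N (\<phi> F) \<subseteq> c n" using n F(1) by (simp add: C_def)
      then show ?thesis by auto
    qed
    then show "(\<Union>n. c n) \<in> C"
      using c by (auto simp: C_def countable_subfamilies_def)
  next
    fix B assume B: "B \<in> countable_subfamilies ?O"
    define next' where "next' = (\<lambda>P. P \<union> (\<Union>F\<in>{F. finite F \<and> F \<subseteq> P}. N (\<phi> F)))"
    define c where "c = (\<lambda>n. (next' ^^ n) B)"
    have c: "c n \<in> countable_subfamilies ?O" for n
    proof (induction n)
      case (Suc n)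
      have "N (\<phi> F) \<in> countable_subfamilies ?O" if "finite F" "F \<subseteq> c n" for F
      proof -
        have "\<phi> F \<in> \<Gamma>" using \<phi>(1)[of F] that Suc by (auto simp: countable_subfamilies_def)
        then show ?thesis using N openin_X by (auto simp: countable_subfamilies_def)
      qed
      then show ?case
        using Suc countable_Collect_finite_subset[of "c n"]
        by (auto simp: c_def next'_def countable_subfamilies_def)
    qed (use B in \<open>simp add: c_def\<close>)
    have mono: "c n \<subseteq> c (Suc n)" for n by (auto simp: c_def next'_def)
    have "N (\<phi> F) \<subseteq> (\<Union>n. c n)" if F: "finite F" "F \<subseteq> (\<Union>n. c n)" for F
    proof -
      obtain n where "F \<subseteq> c n"
        using finite_subset_Union_chain_nat[OF F] mono by auto
      then have "N (\<phi> F) \<subseteq> c (Suc n)" using F(1) by (auto simp: c_def next'_def)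
      then show ?thesis by blast
    qed
    then have "(\<Union>n. c n) \<in> C"
      using c by (auto simp: C_def countable_subfamilies_def)
    moreover have "B \<subseteq> (\<Union>n. c n)" by (use UN_upper[of 0 UNIV c] in \<open>simp add: c_def\<close>)
    ultimately show "\<exists>D\<in>C. B \<subseteq> D" by blast
  qed
  moreover have "sub_bang X P ?O" if P: "P \<in> C" for P
    unfolding sub_bang_def
  proof (intro conjI allI impI ballI)
    show PO: "P \<subseteq> ?O" using P by (auto simp: C_def countable_subfamilies_def)
    have "countable P" using P by (auto simp: C_def countable_subfamilies_def)
    \<comment> \<open>Finite initial pieces of an enumeration of \<open>P\<close>; by monotonicity
      of \<open>\<phi>\<close> their indices form a chain.\<close>
    define F where "F = (\<lambda>n::nat. {U \<in> P. to_nat_on P U < n})"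
    have F: "finite (F n)" "F n \<subseteq> ?O" "F n \<subseteq> P" "F n \<subseteq> F (Suc n)" for n
    proof -
      have "inj_on (to_nat_on P) (F n)"
        using inj_on_to_nat_on[OF \<open>countable P\<close>] by (auto simp: F_def inj_on_def)
      then show "finite (F n)" by (rule inj_on_finite[of _ _ "{..<n}"]) (auto simp: F_def)
      show "F n \<subseteq> ?O" "F n \<subseteq> P" "F n \<subseteq> F (Suc n)" using PO by (auto simp: F_def)
    qed
    have chain: "\<phi> (F n) \<in> \<Gamma>" "le (\<phi> (F n)) (\<phi> (F (Suc n)))" for n
      using \<phi>(1)[OF F(1,2)] \<phi>(3)[OF F(1,2,4)] .
    obtain \<sigma> where \<sigma>': "\<sigma> \<in> \<Gamma>" "\<forall>n. le (\<phi> (F n)) \<sigma>"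
        "\<forall>V x. openin (T \<sigma>) V \<longrightarrow> x \<in> V \<longrightarrow> (\<exists>n W. openin (T (\<phi> (F n))) W \<and> x \<in> W \<and> W \<subseteq> V)"
      by (rule sup_chainE[of "\<lambda>n. \<phi> (F n)", OF allI[OF chain(1)] allI[OF chain(2)]]) (rule that)
    note \<sigma> = \<sigma>'(1) \<sigma>'(2,3)[rule_format]
    \<comment> \<open>At the supremum every neighbourhood shrinks to one from a stage
      \<open>n\<close>, and \<open>P\<close> contains the chosen base of that stage because
      \<open>F n\<close> is a finite subfamily of \<open>P\<close>.\<close>
    have base: "\<exists>W\<in>P. openin (T \<sigma>) W \<and> x \<in> W \<and> W \<subseteq> V" if Vx: "openin (T \<sigma>) V" "x \<in> V" for V x
    proof -
      obtain n V' where V': "openin (T (\<phi> (F n))) V'" "x \<in> V'" "V' \<subseteq> V" 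
        using \<sigma>(3)[OF Vx] by blast
      obtain W where W: "W \<in> N (\<phi> (F n))" "x \<in> W" "W \<subseteq> V'"
        using N(3)[OF chain(1) V'(1,2)] by blast
      moreover have "N (\<phi> (F n)) \<subseteq> P" using P F(1,3) by (simp add: C_def)
      moreover have "openin (T \<sigma>) W"
        using openin_mono[OF \<sigma>(1) chain(1) \<sigma>(2) N(2)[OF chain(1) W(1)]] .
      ultimately show ?thesis using V'(3) by blast
    qed
    fix S x assume S: "S \<subseteq> P" and x: "x \<in> topspace X" "x \<notin> X closure_of \<Union>S"
    have "determines \<sigma> U" if "U \<in> P" for U
    proof -
      \<comment> \<open>Stage \<open>n\<close> holds the members with code below \<open>n\<close>,
        so \<open>U\<close> enters at the successor of its code.\<close>
      have "U \<in> F (Suc (to_nat_on P U))" using that by (simp add: F_def)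
      then have "determines (\<phi> (F (Suc (to_nat_on P U)))) U" using \<phi>(2)[OF F(1,2)] by blast
      then show ?thesis using determines_mono[OF \<sigma>(1) chain(1) \<sigma>(2)] by blast
    qed
    then obtain v where v: "\<And>U. U \<in> P \<Longrightarrow> openin (T \<sigma>) (v U)" "\<And>U. U \<in> P \<Longrightarrow> v U \<subseteq> U"
        "\<And>U. U \<in> P \<Longrightarrow> U \<subseteq> X closure_of (v U)"
      unfolding determines_def by metis
    \<comment> \<open>A \<open>T \<sigma>\<close>-open replacement for the union of
      \<open>S\<close>, dense in it.\<close>
    define G where "G = \<Union>(v ` S)"
    have "openin (T \<sigma>) G" using v(1) S unfolding G_def by blast
    moreover have "G \<subseteq> \<Union>S" using v(2) S unfolding G_def by (meson UN_least Union_upper order_trans subsetD)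
    ultimately have G: "openin (T \<sigma>) G" "G \<subseteq> \<Union>S" .
    have SG: "\<Union>S \<subseteq> X closure_of G"
    proof
      fix y assume "y \<in> \<Union>S"
      then obtain U where U: "U \<in> S" "y \<in> U" by blast
      then have "y \<in> X closure_of (v U)" using v(3) S by blast
      moreover have "v U \<subseteq> G" using U by (auto simp: G_def)
      ultimately show "y \<in> X closure_of G" using closure_of_mono by blast
    qed
    \<comment> \<open>Two closures are crossed. \<open>W0\<close> lies in the
      \<open>T \<sigma>\<close>-closure of \<open>?D\<close>; the \<open>T \<sigma>\<close>-open
      \<open>G\<close> misses \<open>?D\<close>, hence that closure, hence \<open>W0\<close>. As
      \<open>W0\<close> is open in \<open>X\<close>, it also misses the \<open>X\<close>-closure of
      \<open>G\<close>, which contains the union of \<open>S\<close>.\<close>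
    let ?D = "topspace X - X closure_of \<Union>S"
    have "openin X ?D" by (simp add: openin_diff)
    then obtain W0 where W0: "openin (T \<sigma>) W0" "x \<in> W0" "W0 \<subseteq> T \<sigma> closure_of ?D"
      using d_open_X[OF \<sigma>(1), of ?D x] x by blast
    have "\<Union>S \<subseteq> X closure_of \<Union>S"
      using S PO by (intro closure_of_subset) (auto dest: openin_subset)
    then have "G \<inter> ?D = {}" using G(2) by blast
    then have "G \<inter> T \<sigma> closure_of ?D = {}" using openin_Int_closure_of_eq_empty[OF G(1)] by blast
    then have "W0 \<inter> G = {}" using W0(3) by blast
    then have "W0 \<inter> X closure_of G = {}"
      using openin_Int_closure_of_eq_empty[OF openin_X[OF \<sigma>(1) W0(1)]] by blast
    moreover obtain W where "W \<in> P" "x \<in> W" "W \<subseteq> W0" using base[OF W0(1,2)] by blast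
    ultimately show "\<exists>W\<in>P. x \<in> W \<and> W \<inter> \<Union>S = {}" using SG by blast
  qed
  ultimately show ?thesis
    unfolding very_I_favorable_def C_def by blast
qed

end

section \<open>Pulling the topologies of a good system back to the space\<close>

lemma directed_finite_upper_bound:
  assumes "\<Gamma> \<noteq> {}" and "\<forall>\<sigma>\<in>\<Gamma>. \<forall>\<rho>\<in>\<Gamma>. \<exists>\<tau>\<in>\<Gamma>. le \<sigma> \<tau> \<and> le \<rho> \<tau>"
    and "\<forall>\<sigma>\<in>\<Gamma>. \<forall>\<rho>\<in>\<Gamma>. \<forall>\<tau>\<in>\<Gamma>. le \<tau> \<rho> \<and> le \<rho> \<sigma> \<longrightarrow> le \<tau> \<sigma>"
    and "finite K" "K \<subseteq> \<Gamma>"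
  shows "\<exists>\<sigma>\<in>\<Gamma>. \<forall>\<kappa>\<in>K. le \<kappa> \<sigma>"
  using assms(4,5)
proof (induction K)
  case empty
  then show ?case using assms(1) by blast
next
  case (insert k K)
  then obtain \<sigma> where \<sigma>: "\<sigma> \<in> \<Gamma>" "\<forall>\<kappa>\<in>K. le \<kappa> \<sigma>" by auto
  obtain \<tau> where \<tau>: "\<tau> \<in> \<Gamma>" "le \<sigma> \<tau>" "le k \<tau>"
    using assms(2) \<sigma>(1) insert.prems by (meson insert_subset)
  have "le \<kappa> \<tau>" if "\<kappa> \<in> K" for \<kappa>
    using assms(3) \<tau> \<sigma> that insert.prems by (meson insert_subset subsetD)
  then show ?case using \<tau> by blast
qed

lemma chain_le:
  assumes "\<forall>\<sigma>\<in>\<Gamma>. le \<sigma> \<sigma>" and "\<forall>\<sigma>\<in>\<Gamma>. \<forall>\<rho>\<in>\<Gamma>. \<forall>\<tau>\<in>\<Gamma>. le \<tau> \<rho> \<and> le \<rho> \<sigma> \<longrightarrow> le \<tau> \<sigma>"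
    and "\<forall>n::nat. s n \<in> \<Gamma>" "\<forall>n. le (s n) (s (Suc n))" and "m \<le> n"
  shows "le (s m) (s n)"
  using \<open>m \<le> n\<close>
proof (induction n rule: dec_induct)
  case base
  then show ?case using assms(1,3) by blast
next
  case (step n)
  then show ?case using assms(2-4) by meson
qed

text \<open>\<open>T \<sigma>\<close> is the initial topology of the coordinate at
  \<open>\<sigma>\<close> of the embedding \<open>e\<close>. Since the points \<open>e x\<close> are
  threads, these topologies grow with the index; boxes in the product give \<open>base_X\<close>,
  boxes in the product over a chain give \<open>sup_chain\<close>, and surjectivity of the
  coordinates transports closures from the \<open>Xs \<rho>\<close> back to
  \<open>X\<close>.\<close>

lemma good_system_imp_topology_system:
  assumes good: "good_system X \<Gamma> le Xs q" and "\<Gamma> \<noteq> {}"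
  shows "\<exists>T. topology_system X \<Gamma> le T"
proof -
  have sys: "inverse_system \<Gamma> le Xs q" "sigma_complete \<Gamma> le Xs q"
      "\<forall>\<sigma>\<in>\<Gamma>. second_countable (Xs \<sigma>)"
      "\<forall>\<sigma>\<in>\<Gamma>. \<forall>\<rho>\<in>\<Gamma>. le \<rho> \<sigma> \<longrightarrow> d_open_map (Xs \<sigma>) (Xs \<rho>) (q \<sigma> \<rho>)"
      "almost_limit X \<Gamma> le Xs q"
    using good unfolding good_system_def by auto
  have refl: "\<forall>\<sigma>\<in>\<Gamma>. le \<sigma> \<sigma>"
    and trans: "\<forall>\<sigma>\<in>\<Gamma>. \<forall>\<rho>\<in>\<Gamma>. \<forall>\<tau>\<in>\<Gamma>. le \<tau> \<rho> \<and> le \<rho> \<sigma> \<longrightarrow> le \<tau> \<sigma>"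
    and dir: "\<forall>\<sigma>\<in>\<Gamma>. \<forall>\<rho>\<in>\<Gamma>. \<exists>\<tau>\<in>\<Gamma>. le \<sigma> \<tau> \<and> le \<rho> \<tau>"
    and cont_q: "\<forall>\<sigma>\<in>\<Gamma>. \<forall>\<rho>\<in>\<Gamma>. le \<rho> \<sigma> \<longrightarrow> continuous_map (Xs \<sigma>) (Xs \<rho>) (q \<sigma> \<rho>)"
    using sys(1) unfolding inverse_system_def by (iprover, iprover, iprover, iprover)
  obtain e where e: "embedding_map X (inv_limit \<Gamma> le Xs q) e"
      and surj: "\<forall>\<sigma>\<in>\<Gamma>. (\<lambda>x. e x \<sigma>) ` topspace X = topspace (Xs \<sigma>)"
    using sys(5) unfolding almost_limit_def by blast
  have emb: "embedding_map X (product_topology Xs \<Gamma>) e"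
    and thread: "\<forall>x\<in>topspace X. \<forall>\<sigma>\<in>\<Gamma>. \<forall>\<rho>\<in>\<Gamma>. le \<rho> \<sigma> \<longrightarrow> q \<sigma> \<rho> (e x \<sigma>) = e x \<rho>"
    using e unfolding inv_limit_def embedding_map_in_subtopology by auto
  have cont_e: "continuous_map X (Xs \<sigma>) (\<lambda>x. e x \<sigma>)" if "\<sigma> \<in> \<Gamma>" for \<sigma>
    using embedding_imp_continuous_map[OF emb] that unfolding continuous_map_componentwise by blast
  have e_in: "e x \<sigma> \<in> topspace (Xs \<sigma>)" if "\<sigma> \<in> \<Gamma>" "x \<in> topspace X" for \<sigma> x
    using surj that by blast
  define T where "T = (\<lambda>\<sigma>. pullback_topology (topspace X) (\<lambda>x. e x \<sigma>) (Xs \<sigma>))"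
  have openin_T: "openin (T \<sigma>) U \<longleftrightarrow> (\<exists>V. openin (Xs \<sigma>) V \<and> U = {x \<in> topspace X. e x \<sigma> \<in> V})" for \<sigma> U
    unfolding T_def openin_pullback_topology by (simp add: vimage_def Int_def conj_commute)
  have topspace_T: "topspace (T \<sigma>) = topspace X" if "\<sigma> \<in> \<Gamma>" for \<sigma>
    unfolding T_def topspace_pullback_topology using e_in that by auto
  have mono_T: "openin (T \<sigma>) U" if "\<sigma> \<in> \<Gamma>" "\<rho> \<in> \<Gamma>" "le \<rho> \<sigma>" "openin (T \<rho>) U" for \<sigma> \<rho> U
  proof -
    obtain V where V: "openin (Xs \<rho>) V" "U = {x \<in> topspace X. e x \<rho> \<in> V}"
      using \<open>openin (T \<rho>) U\<close> openin_T by blast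
    have "openin (Xs \<sigma>) {y \<in> topspace (Xs \<sigma>). q \<sigma> \<rho> y \<in> V}"
      using openin_continuous_map_preimage cont_q that V(1) by blast
    moreover have "U = {x \<in> topspace X. e x \<sigma> \<in> {y \<in> topspace (Xs \<sigma>). q \<sigma> \<rho> y \<in> V}}"
      using V(2) thread that e_in by auto
    ultimately show ?thesis using openin_T by blast
  qed
  \<comment> \<open>The map \<open>t\<close> from labels to indices allows two uses: with the
    identity for boxes over \<open>\<Gamma>\<close>, and with a sequence \<open>s\<close> for boxes
    over the natural numbers.\<close>
  have box: "openin (T \<tau>) {y \<in> topspace X. \<forall>i\<in>K. e y (t i) \<in> V i}"
    if "\<tau> \<in> \<Gamma>" "finite K" "\<forall>i\<in>K. t i \<in> \<Gamma> \<and> le (t i) \<tau> \<and> openin (Xs (t i)) (V i)"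
    for \<tau> t V and K :: "'j set"
  proof -
    have "openin (T \<tau>) {y \<in> topspace X. e y (t i) \<in> V i}" if "i \<in> K" for i
      using mono_T[OF \<open>\<tau> \<in> \<Gamma>\<close>, of "t i"] openin_T
        \<open>\<forall>i\<in>K. t i \<in> \<Gamma> \<and> le (t i) \<tau> \<and> openin (Xs (t i)) (V i)\<close> that by blast
    then have "openin (T \<tau>) (topspace (T \<tau>) \<inter> \<Inter>((\<lambda>i. {y \<in> topspace X. e y (t i) \<in> V i}) ` K))"
      using \<open>finite K\<close> by (intro openin_Int_Inter) auto
    moreover have "topspace (T \<tau>) \<inter> \<Inter>((\<lambda>i. {y \<in> topspace X. e y (t i) \<in> V i}) ` K)
        = {y \<in> topspace X. \<forall>i\<in>K. e y (t i) \<in> V i}"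
      using topspace_T[OF \<open>\<tau> \<in> \<Gamma>\<close>] by auto
    ultimately show ?thesis by simp
  qed
  have "topology_system X \<Gamma> le T"
  proof
    show "\<Gamma> \<noteq> {}" by fact
    show "le \<sigma> \<sigma>" if "\<sigma> \<in> \<Gamma>" for \<sigma> using refl that by blast
    show "le \<tau> \<sigma>" if "\<sigma> \<in> \<Gamma>" "\<rho> \<in> \<Gamma>" "\<tau> \<in> \<Gamma>" "le \<tau> \<rho>" "le \<rho> \<sigma>" for \<sigma> \<rho> \<tau>
      using trans that by blast
    show "\<exists>\<tau>\<in>\<Gamma>. le \<sigma> \<tau> \<and> le \<rho> \<tau>" if "\<sigma> \<in> \<Gamma>" "\<rho> \<in> \<Gamma>" for \<sigma> \<rho> using dir that by blast
    show "topspace (T \<sigma>) = topspace X" if "\<sigma> \<in> \<Gamma>" for \<sigma> using topspace_T that .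
    show "openin (T \<sigma>) U" if "\<sigma> \<in> \<Gamma>" "\<rho> \<in> \<Gamma>" "le \<rho> \<sigma>" "openin (T \<rho>) U" for \<sigma> \<rho> U
      using mono_T that .
    show "openin X U" if "\<sigma> \<in> \<Gamma>" "openin (T \<sigma>) U" for \<sigma> U
      using that openin_T openin_continuous_map_preimage[OF cont_e] by auto
  next
    fix \<sigma> assume \<sigma>: "\<sigma> \<in> \<Gamma>"
    have "second_countable (Xs \<sigma>)" using sys(3) \<sigma> by blast
    then obtain B where B: "countable B" "\<forall>V\<in>B. openin (Xs \<sigma>) V"
        "\<forall>V x. openin (Xs \<sigma>) V \<and> x \<in> V \<longrightarrow> (\<exists>W\<in>B. x \<in> W \<and> W \<subseteq> V)"
      unfolding second_countable_def by (elim exE conjE)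
    let ?f = "\<lambda>V. {x \<in> topspace X. e x \<sigma> \<in> V}"
    show "second_countable (T \<sigma>)"
      unfolding second_countable_def
    proof (intro exI[of _ "?f ` B"] conjI allI impI)
      show "countable (?f ` B)" using B(1) by simp
      show "\<forall>V\<in>?f ` B. openin (T \<sigma>) V" using B(2) openin_T by auto
      fix U x assume "openin (T \<sigma>) U \<and> x \<in> U"
      then obtain V where V: "openin (Xs \<sigma>) V" "U = ?f V" "x \<in> topspace X" "e x \<sigma> \<in> V"
        using openin_T by auto
      then obtain W where "W \<in> B" "e x \<sigma> \<in> W" "W \<subseteq> V" using B(3) by meson
      then show "\<exists>V\<in>?f ` B. x \<in> V \<and> V \<subseteq> U" using V by (intro bexI[of _ "?f W"]) auto
    qed
  next
    fix U x assume U: "openin X U" "x \<in> U"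
    from embedding_product_base[OF emb U] obtain K V where K: "finite K" "K \<subseteq> \<Gamma>"
        "\<forall>i\<in>K. openin (Xs i) (V i)" "\<forall>i\<in>K. e x i \<in> V i"
        "\<forall>y\<in>topspace X. (\<forall>i\<in>K. e y i \<in> V i) \<longrightarrow> y \<in> U" .
    obtain \<tau> where \<tau>: "\<tau> \<in> \<Gamma>" "\<forall>\<kappa>\<in>K. le \<kappa> \<tau>"
      using directed_finite_upper_bound[OF \<open>\<Gamma> \<noteq> {}\<close> dir trans K(1,2)] by blast
    have "openin (T \<tau>) {y \<in> topspace X. \<forall>i\<in>K. e y i \<in> V i}"
      using box[of \<tau> K "\<lambda>i. i" V] \<tau> K by blast
    moreover have "x \<in> topspace X" using openin_subset[OF U(1)] U(2) by blast
    ultimately show "\<exists>\<sigma>\<in>\<Gamma>. \<exists>V. openin (T \<sigma>) V \<and> x \<in> V \<and> V \<subseteq> U"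
      using \<tau>(1) K(4,5) by (intro bexI[of _ \<tau>] exI[of _ "{y \<in> topspace X. \<forall>i\<in>K. e y i \<in> V i}"]) auto
  next
    fix s :: "nat \<Rightarrow> 'b" assume "\<And>n. s n \<in> \<Gamma>" "\<And>n. le (s n) (s (Suc n))"
    then have s: "\<forall>n. s n \<in> \<Gamma>" "\<forall>n. le (s n) (s (Suc n))" by auto
    then obtain \<sigma> where \<sigma>: "\<sigma> \<in> \<Gamma>" "\<forall>n. le (s n) \<sigma>" "\<forall>\<tau>\<in>\<Gamma>. (\<forall>n. le (s n) \<tau>) \<longrightarrow> le \<sigma> \<tau>"
        "homeomorphic_map (Xs \<sigma>) (inv_seq_limit s Xs q) (\<lambda>x n. q \<sigma> (s n) x)"
      using sys(2) unfolding sigma_complete_def by meson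
    \<comment> \<open>A homeomorphism onto the subspace of threads is an embedding into the whole
      product.\<close>
    have emb_s: "embedding_map (Xs \<sigma>) (product_topology (\<lambda>n. Xs (s n)) UNIV) (\<lambda>x n. q \<sigma> (s n) x)"
      using \<sigma>(4) unfolding surjective_embedding_map[symmetric] inv_seq_limit_def embedding_map_in_subtopology
      by blast
    have "\<exists>n V. openin (T (s n)) V \<and> x \<in> V \<and> V \<subseteq> U" if "openin (T \<sigma>) U" "x \<in> U" for U x
    proof -
      obtain V where V: "openin (Xs \<sigma>) V" "U = {x \<in> topspace X. e x \<sigma> \<in> V}"
        using \<open>openin (T \<sigma>) U\<close> openin_T by blast
      have x: "x \<in> topspace X" "e x \<sigma> \<in> V" using V(2) \<open>x \<in> U\<close> by auto
      from embedding_product_base[OF emb_s V(1) x(2)] obtain K G where K: "finite K"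
          "\<forall>i\<in>K. openin (Xs (s i)) (G i)" "\<forall>i\<in>K. q \<sigma> (s i) (e x \<sigma>) \<in> G i"
          "\<forall>y\<in>topspace (Xs \<sigma>). (\<forall>i\<in>K. q \<sigma> (s i) y \<in> G i) \<longrightarrow> y \<in> V" .
      have q: "q \<sigma> (s i) (e y \<sigma>) = e y (s i)" if "y \<in> topspace X" for y i
        using thread that \<sigma>(1,2) s(1) by blast
      \<comment> \<open>All finitely many coordinates of the box are visible at one stage; inserting
        0 keeps \<open>Max\<close> meaningful for empty \<open>K\<close>.\<close>
      have "le (s i) (s (Max (insert 0 K)))" if "i \<in> K" for i
        using that K(1) by (intro chain_le[OF refl trans s]) simp
      then have "openin (T (s (Max (insert 0 K)))) {y \<in> topspace X. \<forall>i\<in>K. e y (s i) \<in> G i}"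
        using box[of "s (Max (insert 0 K))" K s G] s K by blast
      moreover have "x \<in> {y \<in> topspace X. \<forall>i\<in>K. e y (s i) \<in> G i}"
        using x K(3) q by auto
      moreover have "{y \<in> topspace X. \<forall>i\<in>K. e y (s i) \<in> G i} \<subseteq> U"
        using K(4) q V(2) e_in[OF \<sigma>(1)] by auto
      ultimately show ?thesis by blast
    qed
    then show "\<exists>\<sigma>\<in>\<Gamma>. (\<forall>n. le (s n) \<sigma>) \<and> (\<forall>\<tau>\<in>\<Gamma>. (\<forall>n. le (s n) \<tau>) \<longrightarrow> le \<sigma> \<tau>) \<and>
        (\<forall>U x. openin (T \<sigma>) U \<longrightarrow> x \<in> U \<longrightarrow> (\<exists>n V. openin (T (s n)) V \<and> x \<in> V \<and> V \<subseteq> U))"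
      using \<sigma>(1-3) by (intro bexI[of _ \<sigma>]) auto
  next
    fix \<sigma> \<rho> U x assume \<sigma>: "\<sigma> \<in> \<Gamma>" "\<rho> \<in> \<Gamma>" "le \<rho> \<sigma>" and U: "openin (T \<sigma>) U" "x \<in> U"
    obtain V where V: "openin (Xs \<sigma>) V" "U = {x \<in> topspace X. e x \<sigma> \<in> V}"
      using U(1) openin_T by blast
    have x: "x \<in> topspace X" "e x \<sigma> \<in> V" using V(2) U(2) by auto
    have q: "q \<sigma> \<rho> (e y \<sigma>) = e y \<rho>" if "y \<in> topspace X" for y
      using thread that \<sigma> by blast
    have "d_open_map (Xs \<sigma>) (Xs \<rho>) (q \<sigma> \<rho>)" using sys(4) \<sigma> by blast
    from d_open_mapD[OF this V(1) x(2)] obtain W where W: "openin (Xs \<rho>) W" "q \<sigma> \<rho> (e x \<sigma>) \<in> W"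
        "W \<subseteq> Xs \<rho> closure_of (q \<sigma> \<rho> ` V)" .
    \<comment> \<open>The closure in \<open>Xs \<rho>\<close> yields a point \<open>v\<close> of
      \<open>V\<close> mapped into \<open>H\<close>; surjectivity of the coordinate at
      \<open>\<sigma>\<close> makes it the image of a point of \<open>X\<close>, which lies in
      \<open>U\<close> and \<open>G\<close>.\<close>
    have "y \<in> T \<rho> closure_of U" if y: "y \<in> topspace X" "e y \<rho> \<in> W" for y
      unfolding in_closure_of
    proof (intro conjI allI impI)
      show "y \<in> topspace (T \<rho>)" using y topspace_T \<sigma>(2) by simp
      fix G assume "y \<in> G \<and> openin (T \<rho>) G"
      then obtain H where H: "openin (Xs \<rho>) H" "G = {x \<in> topspace X. e x \<rho> \<in> H}" "e y \<rho> \<in> H"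
        using openin_T by auto
      have "e y \<rho> \<in> Xs \<rho> closure_of (q \<sigma> \<rho> ` V)" using W(3) y(2) by blast
      then obtain v where v: "v \<in> V" "q \<sigma> \<rho> v \<in> H"
        using H(1,3) unfolding in_closure_of by blast
      then have "v \<in> topspace (Xs \<sigma>)" using openin_subset[OF V(1)] by blast
      then obtain z where "z \<in> topspace X" "v = e z \<sigma>" using surj \<sigma>(1) by blast
      then show "\<exists>z. z \<in> U \<and> z \<in> G" using v V(2) H(2) q by auto
    qed
    then show "\<exists>W. openin (T \<rho>) W \<and> x \<in> W \<and> W \<subseteq> T \<rho> closure_of U"
      using openin_T W x q by (intro exI[of _ "{y \<in> topspace X. e y \<rho> \<in> W}"]) auto
  qed
  then show ?thesis by blast
qed

text \<open>\<open>inverse_system\<close> admits an empty index set. The empty product is a single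
  point, so in that case \<open>X\<close> embeds in a point and has finitely many open sets.
  Otherwise the pulled back topologies apply.\<close>

lemma good_system_imp_very_I_favorable:
  assumes good: "good_system X \<Gamma> le Xs q"
  shows "very_I_favorable X"
proof (cases "\<Gamma> = {}")
  case True
  obtain e where e: "embedding_map X (inv_limit \<Gamma> le Xs q) e"
    using good unfolding good_system_def almost_limit_def by blast
  have "e ` topspace X \<subseteq> topspace (product_topology Xs \<Gamma>)"
    using continuous_map_image_subset_topspace[OF embedding_imp_continuous_map[OF e]]
    unfolding inv_limit_def by auto
  then have "finite (e ` topspace X)"
    using True by (auto intro: finite_subset)
  moreover have "inj_on e (topspace X)"
    using e unfolding embedding_map_def by (blast dest: homeomorphic_imp_injective_map)
  ultimately have "finite (topspace X)" using finite_imageD by blast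
  then have "finite {U. openin X U}"
    by (auto intro!: finite_subset[of _ "Pow (topspace X)"] dest: openin_subset)
  then show ?thesis by (simp add: countable_opens_imp_very_I_favorable countable_finite)
next
  case False
  then show ?thesis
    using good_system_imp_topology_system[OF good] topology_system.very_I_favorable by blast
qed

subsection \<open>From clubs to inverse systems\<close>

text \<open>A homeomorphic copy of \<open>Y\<close> with each point \<open>x\<close> renamed to
  \<open>{x}\<close>. This yields spaces with points of type \<open>'a set\<close>, the type named
  in the final theorem.\<close>

definition singleton_copy :: "'a topology \<Rightarrow> 'a set topology" where
  "singleton_copy Y = pullback_topology (range (\<lambda>x. {x})) the_elem Y"

lemma openin_singleton_copy:
  "openin (singleton_copy Y) V \<longleftrightarrow> (\<exists>U. openin Y U \<and> V = (\<lambda>x. {x}) ` U)"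
proof -
  have "the_elem -` U \<inter> range (\<lambda>x. {x}) = (\<lambda>x. {x}) ` U" for U :: "'a set" by auto
  then show ?thesis by (simp add: singleton_copy_def openin_pullback_topology)
qed

lemma openin_singleton_copy_image [simp]:
  "openin (singleton_copy Y) ((\<lambda>x. {x}) ` U) \<longleftrightarrow> openin Y U"
  by (auto simp: openin_singleton_copy inj_image_eq_iff)

lemma topspace_singleton_copy [simp]: "topspace (singleton_copy Y) = (\<lambda>x. {x}) ` topspace Y"
  unfolding singleton_copy_def topspace_pullback_topology by auto

lemma continuous_map_into_singleton_copy:
  assumes "topspace Z = topspace Y" "\<And>U. openin Y U \<Longrightarrow> openin Z U"
  shows "continuous_map Z (singleton_copy Y) (\<lambda>x. {x})"
  unfolding continuous_map_def
proof (intro conjI allI impI)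
  fix V assume "openin (singleton_copy Y) V"
  then obtain U where U: "openin Y U" "V = (\<lambda>x. {x}) ` U" unfolding openin_singleton_copy by blast
  then have "{x \<in> topspace Z. {x} \<in> V} = U" using openin_subset[OF U(1)] assms(1) by auto
  then show "openin Z {x \<in> topspace Z. {x} \<in> V}" using assms(2) U(1) by simp
qed (use assms(1) in auto)

lemma continuous_map_singleton_copies:
  assumes "topspace Z = topspace Y" "\<And>U. openin Y U \<Longrightarrow> openin Z U"
  shows "continuous_map (singleton_copy Z) (singleton_copy Y) (\<lambda>v. v)"
  unfolding continuous_map_def
proof (intro conjI allI impI)
  fix V assume "openin (singleton_copy Y) V"
  then obtain U where U: "openin Y U" "V = (\<lambda>x. {x}) ` U" unfolding openin_singleton_copy by blast
  then have "{v \<in> topspace (singleton_copy Z). v \<in> V} = (\<lambda>x. {x}) ` U"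
    using openin_subset[OF U(1)] assms(1) by auto
  then show "openin (singleton_copy Z) {v \<in> topspace (singleton_copy Z). v \<in> V}"
    using assms(2) U(1) by simp
qed (use assms(1) in auto)

lemma second_countable_singleton_copy:
  assumes "second_countable Y"
  shows "second_countable (singleton_copy Y)"
proof -
  obtain B where B: "countable B" "\<forall>V\<in>B. openin Y V"
      "\<forall>V x. openin Y V \<and> x \<in> V \<longrightarrow> (\<exists>W\<in>B. x \<in> W \<and> W \<subseteq> V)"
    using assms unfolding second_countable_def by (elim exE conjE)
  let ?f = "\<lambda>U. (\<lambda>x. {x}) ` U"
  show ?thesis
    unfolding second_countable_def
  proof (intro exI[of _ "?f ` B"] conjI allI impI)
    show "countable (?f ` B)" using B(1) by simp
    show "\<forall>V\<in>?f ` B. openin (singleton_copy Y) V" using B(2) by auto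
    fix V v assume "openin (singleton_copy Y) V \<and> v \<in> V"
    then obtain U x where U: "openin Y U" "V = ?f U" "x \<in> U" "v = {x}"
      unfolding openin_singleton_copy by auto
    then obtain W where "W \<in> B" "x \<in> W" "W \<subseteq> U" using B(3) by meson
    then show "\<exists>W\<in>?f ` B. v \<in> W \<and> W \<subseteq> V" using U by (intro bexI[of _ "?f W"]) auto
  qed
qed

context topology_system
begin

text \<open>
  The \<open>X\<^sub>\<sigma>\<close> need not be \<open>T\<^sub>0\<close>, so they can share the point set of \<open>X\<close> and all bonding maps can be
  the identity. Threads are then constant, and \<open>\<sigma>\<close>-completeness reduces to a comparison of topologies.
\<close>

theorem good_system_singleton_copies: "good_system X \<Gamma> le (\<lambda>\<sigma>. singleton_copy (T \<sigma>)) (\<lambda>_ _ v. v)"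
proof -
  let ?Xs = "\<lambda>\<sigma>. singleton_copy (T \<sigma>)" and ?q = "\<lambda>_ _ v. v"
  have cont: "continuous_map (?Xs \<sigma>) (?Xs \<rho>) (\<lambda>v. v)" if "\<sigma> \<in> \<Gamma>" "\<rho> \<in> \<Gamma>" "le \<rho> \<sigma>" for \<sigma> \<rho>
    using topspace_T openin_mono[OF that] that by (intro continuous_map_singleton_copies) auto
  have "inverse_system \<Gamma> le ?Xs ?q"
    unfolding inverse_system_def
  proof (intro conjI ballI impI)
    show "le \<tau> \<sigma>" if "\<sigma> \<in> \<Gamma>" "\<rho> \<in> \<Gamma>" "\<tau> \<in> \<Gamma>" "le \<tau> \<rho> \<and> le \<rho> \<sigma>" for \<sigma> \<rho> \<tau>
      using le_trans[OF that(1-3)] that(4) by blast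
  qed (simp_all add: le_refl directed cont)
  moreover have "sigma_complete \<Gamma> le ?Xs ?q"
    unfolding sigma_complete_def
  proof (intro allI impI, elim conjE)
    fix s :: "nat \<Rightarrow> 'i" assume "\<forall>n. s n \<in> \<Gamma>" "\<forall>n. le (s n) (s (Suc n))"
    then have s: "\<And>n. s n \<in> \<Gamma>" "\<And>n. le (s n) (s (Suc n))" by auto
    obtain \<sigma> where \<sigma>: "\<sigma> \<in> \<Gamma>" "\<forall>n. le (s n) \<sigma>" "\<forall>\<tau>\<in>\<Gamma>. (\<forall>n. le (s n) \<tau>) \<longrightarrow> le \<sigma> \<tau>"
        "\<forall>U x. openin (T \<sigma>) U \<longrightarrow> x \<in> U \<longrightarrow> (\<exists>n V. openin (T (s n)) V \<and> x \<in> V \<and> V \<subseteq> U)"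
      using sup_chain[of s, OF s] by (elim bexE conjE)
    have "embedding_map (?Xs \<sigma>) (product_topology (\<lambda>n. ?Xs (s n)) UNIV) (\<lambda>v. \<lambda>n\<in>UNIV. v)"
    proof (rule diagonal_embedding)
      show "continuous_map (?Xs \<sigma>) (?Xs (s n)) (\<lambda>v. v)" for n using cont \<sigma>(1,2) s(1) by blast
      show "topspace (?Xs (s n)) = (\<lambda>v. v) ` topspace (?Xs \<sigma>)" for n
        using topspace_T[OF s(1)] topspace_T[OF \<sigma>(1)] by simp
      fix V v assume V: "openin (?Xs \<sigma>) V" "v \<in> V"
      then obtain U x where U: "openin (T \<sigma>) U" "V = (\<lambda>x. {x}) ` U" "x \<in> U" "v = {x}"
        unfolding openin_singleton_copy by auto
      then obtain n W where W: "openin (T (s n)) W" "x \<in> W" "W \<subseteq> U" using \<sigma>(4) by meson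
      then show "\<exists>n\<in>UNIV. \<exists>W. openin (?Xs (s n)) W \<and> v \<in> W \<and> W \<subseteq> (\<lambda>v. v) ` V"
        using U by (intro bexI[of _ n] exI[of _ "(\<lambda>x. {x}) ` W"]) auto
    qed auto
    then have emb: "embedding_map (?Xs \<sigma>) (product_topology (\<lambda>n. ?Xs (s n)) UNIV) (\<lambda>v n. v)"
      by (simp add: restrict_def)
    have top: "topspace (?Xs (s n)) = topspace (?Xs \<sigma>)" for n
      using topspace_T[OF s(1)] topspace_T[OF \<sigma>(1)] by simp
    have const: "y = (\<lambda>n. y 0)" if "\<forall>n. y (Suc n) = y n" for y :: "nat \<Rightarrow> 'a set"
    proof
      fix n show "y n = y 0" using that by (induction n) auto
    qed
    let ?L = "{y \<in> topspace (product_topology (\<lambda>n. ?Xs (s n)) UNIV). \<forall>n. y (Suc n) = y n}"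
    \<comment> \<open>The diagonal hits every thread of the sequence, so the embedding
      \<open>emb\<close> is a homeomorphism onto the whole sequence limit.\<close>
    have L: "?L = (\<lambda>v n. v) ` topspace (?Xs \<sigma>)"
    proof
      show "(\<lambda>v n. v) ` topspace (?Xs \<sigma>) \<subseteq> ?L" using top by auto
      show "?L \<subseteq> (\<lambda>v n. v) ` topspace (?Xs \<sigma>)"
      proof
        fix y assume y: "y \<in> ?L"
        then have "y 0 \<in> topspace (?Xs (s 0))" by (auto simp: PiE_iff)
        then have "y 0 \<in> topspace (?Xs \<sigma>)" using top by blast
        moreover have "y = (\<lambda>n. y 0)" using y by (intro const) simp
        ultimately show "y \<in> (\<lambda>v n. v) ` topspace (?Xs \<sigma>)" by (rule image_eqI[rotated])
      qed
    qed
    have "homeomorphic_map (?Xs \<sigma>) (inv_seq_limit s ?Xs ?q) (\<lambda>v n. v)"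
      unfolding inv_seq_limit_def L using emb unfolding embedding_map_def .
    then show "\<exists>\<sigma>\<in>\<Gamma>. (\<forall>n. le (s n) \<sigma>) \<and> (\<forall>\<tau>\<in>\<Gamma>. (\<forall>n. le (s n) \<tau>) \<longrightarrow> le \<sigma> \<tau>) \<and>
        homeomorphic_map (?Xs \<sigma>) (inv_seq_limit s ?Xs ?q) (\<lambda>x n. ?q \<sigma> (s n) x)"
      using \<sigma>(1-3) by blast
  qed
  moreover have "\<forall>\<sigma>\<in>\<Gamma>. second_countable (?Xs \<sigma>)"
    using second_countable_T second_countable_singleton_copy by blast
  moreover have "\<forall>\<sigma>\<in>\<Gamma>. \<forall>\<rho>\<in>\<Gamma>. le \<rho> \<sigma> \<longrightarrow>
      d_open_map (?Xs \<sigma>) (?Xs \<rho>) (?q \<sigma> \<rho>) \<and> ?q \<sigma> \<rho> ` topspace (?Xs \<sigma>) = topspace (?Xs \<rho>)"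
  proof (intro ballI impI conjI)
    fix \<sigma> \<rho> assume \<sigma>: "\<sigma> \<in> \<Gamma>" "\<rho> \<in> \<Gamma>" "le \<rho> \<sigma>"
    then show "?q \<sigma> \<rho> ` topspace (?Xs \<sigma>) = topspace (?Xs \<rho>)" using topspace_T by simp
    show "d_open_map (?Xs \<sigma>) (?Xs \<rho>) (?q \<sigma> \<rho>)"
    proof (rule d_open_mapI)
      show "continuous_map (?Xs \<sigma>) (?Xs \<rho>) (?q \<sigma> \<rho>)" using cont \<sigma> by simp
      fix V v assume V: "openin (?Xs \<sigma>) V" "v \<in> V"
      then obtain U x where U: "openin (T \<sigma>) U" "V = (\<lambda>x. {x}) ` U" "x \<in> U" "v = {x}"
        unfolding openin_singleton_copy by auto
      obtain W where W: "openin (T \<rho>) W" "x \<in> W" "W \<subseteq> T \<rho> closure_of U"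
        using d_open[OF \<sigma> U(1,3)] by blast
      have "{y} \<in> ?Xs \<rho> closure_of V" if "y \<in> W" for y
        unfolding in_closure_of
      proof (intro conjI allI impI)
        have y: "y \<in> T \<rho> closure_of U" using that W(3) by blast
        then show "{y} \<in> topspace (?Xs \<rho>)" by (simp add: in_closure_of)
        fix G assume "{y} \<in> G \<and> openin (?Xs \<rho>) G"
        then obtain H where "openin (T \<rho>) H" "G = (\<lambda>x. {x}) ` H" "y \<in> H"
          unfolding openin_singleton_copy by auto
        moreover from this obtain z where "z \<in> U" "z \<in> H" using y unfolding in_closure_of by blast
        ultimately show "\<exists>z. z \<in> V \<and> z \<in> G" using U(2) by blast
      qed
      then show "\<exists>W. openin (?Xs \<rho>) W \<and> v \<in> W \<and> W \<subseteq> ?Xs \<rho> closure_of ((\<lambda>v. v) ` V)"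
        using W U by (intro exI[of _ "(\<lambda>x. {x}) ` W"]) auto
    qed
  qed
  moreover have "almost_limit X \<Gamma> le ?Xs ?q"
    unfolding almost_limit_def
  proof (intro exI conjI ballI)
    let ?e = "\<lambda>x. \<lambda>\<sigma>\<in>\<Gamma>. {x}"
    have "embedding_map X (product_topology ?Xs \<Gamma>) ?e"
    proof (rule diagonal_embedding)
      show "continuous_map X (?Xs \<sigma>) (\<lambda>x. {x})" if "\<sigma> \<in> \<Gamma>" for \<sigma>
        using topspace_T openin_X that by (intro continuous_map_into_singleton_copy) auto
      show "topspace (?Xs \<sigma>) = (\<lambda>x. {x}) ` topspace X" if "\<sigma> \<in> \<Gamma>" for \<sigma>
        using topspace_T that by simp
      fix U x assume "openin X U" "x \<in> U"
      then obtain \<sigma> V where V: "\<sigma> \<in> \<Gamma>" "openin (T \<sigma>) V" "x \<in> V" "V \<subseteq> U"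
        using base_X[of U x] by blast
      then show "\<exists>\<sigma>\<in>\<Gamma>. \<exists>V. openin (?Xs \<sigma>) V \<and> {x} \<in> V \<and> V \<subseteq> (\<lambda>x. {x}) ` U"
        by (intro bexI[of _ \<sigma>] exI[of _ "(\<lambda>x. {x}) ` V"]) auto
    qed (use nonempty in auto)
    \<comment> \<open>An almost limit asks for an embedding into the limit, not onto it, so it
      suffices that constant families are threads.\<close>
    moreover have "?e ` topspace X \<subseteq> {y \<in> topspace (product_topology ?Xs \<Gamma>).
        \<forall>\<sigma>\<in>\<Gamma>. \<forall>\<rho>\<in>\<Gamma>. le \<rho> \<sigma> \<longrightarrow> ?q \<sigma> \<rho> (y \<sigma>) = y \<rho>}"
      using topspace_T by auto
    ultimately show "embedding_map X (inv_limit \<Gamma> le ?Xs ?q) ?e"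
      unfolding inv_limit_def embedding_map_in_subtopology by blast
    show "(\<lambda>x. ?e x \<sigma>) ` topspace X = topspace (?Xs \<sigma>)" if "\<sigma> \<in> \<Gamma>" for \<sigma>
      using topspace_T that by simp
  qed
  ultimately show ?thesis unfolding good_system_def by (intro conjI)
qed

end

section \<open>Topologies generated by the members of a club\<close>

text \<open>Adding binary intersections alternates with enlarging to a member of \<open>C\<close>.
  The union of the resulting chain is in \<open>C\<close> and inherits closure under intersections,
  since any two of its members occur together at some stage.\<close>

lemma club_Int_closed_unbounded:
  fixes X :: "'a topology"
  assumes club: "is_club {U. openin X U} C" and B: "B \<in> countable_subfamilies {U. openin X U}"
  shows "\<exists>D\<in>C. B \<subseteq> D \<and> (\<forall>U\<in>D. \<forall>V\<in>D. U \<inter> V \<in> D)"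
proof -
  let ?O = "{U. openin X U}"
  define M where "M = (\<lambda>P :: 'a set set. P \<union> (\<lambda>(U, V). U \<inter> V) ` (P \<times> P))"
  have C: "C \<subseteq> countable_subfamilies ?O"
      "\<forall>c :: nat \<Rightarrow> 'a set set. (\<forall>n. c n \<in> C) \<and> (\<forall>n. c n \<subseteq> c (Suc n)) \<longrightarrow> (\<Union>n. c n) \<in> C"
      "\<forall>B \<in> countable_subfamilies ?O. \<exists>D\<in>C. B \<subseteq> D"
    using club unfolding is_club_def by (iprover, iprover, iprover)
  have M: "M P \<in> countable_subfamilies ?O" if "P \<in> countable_subfamilies ?O" for P
    using that by (auto simp: M_def countable_subfamilies_def)
  have "\<exists>c. \<forall>n. (c n \<in> C \<and> B \<subseteq> c n) \<and> M (c n) \<subseteq> c (Suc n)"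
  proof (rule dependent_nat_choice)
    show "\<exists>D. D \<in> C \<and> B \<subseteq> D" using C(3) B by blast
    fix D :: "'a set set" and n :: nat assume D: "D \<in> C \<and> B \<subseteq> D"
    then have "M D \<in> countable_subfamilies ?O" using C(1) M by blast
    then obtain E where "E \<in> C" "M D \<subseteq> E" using C(3) by blast
    moreover have "D \<subseteq> M D" by (simp add: M_def)
    ultimately show "\<exists>E. (E \<in> C \<and> B \<subseteq> E) \<and> M D \<subseteq> E" using D by blast
  qed
  then obtain c where c: "\<forall>n. c n \<in> C" "\<forall>n. B \<subseteq> c n" "\<forall>n. M (c n) \<subseteq> c (Suc n)" by blast
  have mono: "\<forall>n. c n \<subseteq> c (Suc n)" using c(3) by (auto simp: M_def)
  have "U \<inter> V \<in> (\<Union>n. c n)" if "U \<in> (\<Union>n. c n)" "V \<in> (\<Union>n. c n)" for U V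
  proof -
    have "finite {U, V}" "{U, V} \<subseteq> (\<Union>n. c n)" using that by auto
    from finite_subset_Union_chain_nat[OF this mono] obtain n where "{U, V} \<subseteq> c n" ..
    then have "U \<inter> V \<in> M (c n)" by (auto simp: M_def)
    then show ?thesis using c(3) by blast
  qed
  moreover have "(\<Union>n. c n) \<in> C" using C(2) c(1) mono by blast
  moreover have "B \<subseteq> (\<Union>n. c n)" using c(2) by blast
  ultimately show ?thesis by (intro bexI[of _ "\<Union>n. c n"]) auto
qed

text \<open>Each \<open>P\<close> in \<open>\<Gamma>\<close> is a countable base of
  \<open>T P\<close>. The relation \<open>sub_bang\<close> is used twice: for the empty subfamily it
  says that \<open>P\<close> covers \<open>X\<close>, and for the members disjoint from a given open
  set it yields d-openness.\<close>

lemma very_I_favorable_imp_topology_system: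
  fixes X :: "'a topology"
  assumes "very_I_favorable X"
  shows "\<exists>(\<Gamma> :: 'a set set set) T. topology_system X \<Gamma> (\<subseteq>) T"
proof -
  let ?O = "{U. openin X U}"
  obtain C where club: "is_club ?O C" and bang: "\<And>P. P \<in> C \<Longrightarrow> sub_bang X P ?O"
    using assms unfolding very_I_favorable_def by blast
  have C: "C \<subseteq> countable_subfamilies ?O"
      "\<forall>c :: nat \<Rightarrow> 'a set set. (\<forall>n. c n \<in> C) \<and> (\<forall>n. c n \<subseteq> c (Suc n)) \<longrightarrow> (\<Union>n. c n) \<in> C"
    using club unfolding is_club_def by (iprover, iprover)
  \<comment> \<open>Closure under intersections makes \<open>P\<close> a base of a topology. This
    restriction survives unions of chains, and unboundedness is kept by alternating the two
    closures.\<close>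
  define \<Gamma> where "\<Gamma> = {P \<in> C. \<forall>U\<in>P. \<forall>V\<in>P. U \<inter> V \<in> P}"
  define T where "T = (\<lambda>P :: 'a set set. topology (arbitrary union_of (\<lambda>U. U \<in> P)))"
  have unbounded: "\<exists>D\<in>\<Gamma>. B \<subseteq> D" if "B \<in> countable_subfamilies ?O" for B
    using club_Int_closed_unbounded[OF club that] by (auto simp: \<Gamma>_def)
  have openin_T: "openin (T P) U \<longleftrightarrow> (\<forall>x\<in>U. \<exists>V\<in>P. x \<in> V \<and> V \<subseteq> U)" if "P \<in> \<Gamma>" for P U
  proof -
    have "istopology (arbitrary union_of (\<lambda>U. U \<in> P))"
      using that by (intro istopology_base) (simp add: \<Gamma>_def)
    then show ?thesis by (auto simp: T_def topology_inverse' arbitrary_union_of_alt)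
  qed
  have \<Gamma>_open: "openin X U" if "P \<in> \<Gamma>" "U \<in> P" for P U
    using that C(1) by (auto simp: \<Gamma>_def countable_subfamilies_def)
  have \<Gamma>_bang: "\<exists>W\<in>P. x \<in> W \<and> W \<inter> \<Union>S = {}"
    if "P \<in> \<Gamma>" "S \<subseteq> P" "x \<in> topspace X" "x \<notin> X closure_of \<Union>S" for P S x
    using bang[of P] that unfolding \<Gamma>_def sub_bang_def by blast
  have coarser: "openin X U" if P: "P \<in> \<Gamma>" and "openin (T P) U" for P U
    using that openin_subopen[of X U] openin_T[OF P] \<Gamma>_open[OF P] by meson
  have topspace_T: "topspace (T P) = topspace X" if P: "P \<in> \<Gamma>" for P
  proof
    show "topspace (T P) \<subseteq> topspace X" using coarser[OF P openin_topspace] openin_subset by blast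
    have "openin (T P) (topspace X)"
      unfolding openin_T[OF P]
    proof
      fix x assume "x \<in> topspace X"
      \<comment> \<open>The empty subfamily has empty closure, so every point lies in some member of
        \<open>P\<close>.\<close>
      then obtain W where "W \<in> P" "x \<in> W" using \<Gamma>_bang[OF P, of "{}" x] by auto
      then show "\<exists>V\<in>P. x \<in> V \<and> V \<subseteq> topspace X" using \<Gamma>_open[OF P] openin_subset by blast
    qed
    then show "topspace X \<subseteq> topspace (T P)" by (rule openin_subset)
  qed
  have "topology_system X \<Gamma> (\<subseteq>) T"
  proof
    show "\<Gamma> \<noteq> {}" using unbounded[of "{}"] by (auto simp: countable_subfamilies_def)
    show "\<exists>R\<in>\<Gamma>. P \<subseteq> R \<and> Q \<subseteq> R" if "P \<in> \<Gamma>" "Q \<in> \<Gamma>" for P Q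
    proof -
      have "P \<union> Q \<in> countable_subfamilies ?O"
        using that C(1) by (auto simp: \<Gamma>_def countable_subfamilies_def)
      from unbounded[OF this] show ?thesis by auto
    qed
    show "topspace (T P) = topspace X" if "P \<in> \<Gamma>" for P using topspace_T that .
    show "second_countable (T P)" if P: "P \<in> \<Gamma>" for P
      unfolding second_countable_def
    proof (intro exI[of _ P] conjI ballI allI impI)
      show "countable P" using P C(1) by (auto simp: \<Gamma>_def countable_subfamilies_def)
      show "openin (T P) V" if "V \<in> P" for V using openin_T[OF P, of V] that by auto
      show "\<exists>V\<in>P. x \<in> V \<and> V \<subseteq> U" if "openin (T P) U \<and> x \<in> U" for U x
        using openin_T[OF P, of U] that by simp
    qed
    show "openin (T P) U" if "P \<in> \<Gamma>" "Q \<in> \<Gamma>" "Q \<subseteq> P" "openin (T Q) U" for P Q U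
      using that(3,4) openin_T[OF that(1), of U] openin_T[OF that(2), of U] by (meson subsetD)
    show "openin X U" if "P \<in> \<Gamma>" "openin (T P) U" for P U using coarser that .
  next
    fix U x assume U: "openin X U" "x \<in> U"
    then have "{U} \<in> countable_subfamilies ?O" by (simp add: countable_subfamilies_def)
    from unbounded[OF this] obtain P where "P \<in> \<Gamma>" "{U} \<subseteq> P" by auto
    moreover from this have "openin (T P) U" using openin_T[of P U] by auto
    ultimately show "\<exists>P\<in>\<Gamma>. \<exists>V. openin (T P) V \<and> x \<in> V \<and> V \<subseteq> U" using U(2) by blast
  next
    fix s :: "nat \<Rightarrow> 'a set set" assume "\<And>n. s n \<in> \<Gamma>" "\<And>n. s n \<subseteq> s (Suc n)"
    then have s: "\<forall>n. s n \<in> \<Gamma>" "\<forall>n. s n \<subseteq> s (Suc n)" by auto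
    have "U \<inter> V \<in> (\<Union>n. s n)" if "U \<in> (\<Union>n. s n)" "V \<in> (\<Union>n. s n)" for U V
    proof -
      have "finite {U, V}" "{U, V} \<subseteq> (\<Union>n. s n)" using that by auto
      from finite_subset_Union_chain_nat[OF this s(2)] obtain n where "{U, V} \<subseteq> s n" ..
      then have "U \<inter> V \<in> s n" using s(1) by (simp add: \<Gamma>_def)
      then show ?thesis by blast
    qed
    moreover have "(\<Union>n. s n) \<in> C" using C(2) s by (simp add: \<Gamma>_def)
    ultimately have sup: "(\<Union>n. s n) \<in> \<Gamma>" by (simp add: \<Gamma>_def)
    have "\<exists>n V. openin (T (s n)) V \<and> x \<in> V \<and> V \<subseteq> U" if U: "openin (T (\<Union>n. s n)) U" "x \<in> U" for U x
    proof -
      obtain V n where V: "V \<in> s n" "x \<in> V" "V \<subseteq> U" using U openin_T[OF sup, of U] by auto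
      then have "openin (T (s n)) V" using openin_T[of "s n" V] s(1) by auto
      then show ?thesis using V by blast
    qed
    then show "\<exists>P\<in>\<Gamma>. (\<forall>n. s n \<subseteq> P) \<and> (\<forall>R\<in>\<Gamma>. (\<forall>n. s n \<subseteq> R) \<longrightarrow> P \<subseteq> R) \<and>
        (\<forall>U x. openin (T P) U \<longrightarrow> x \<in> U \<longrightarrow> (\<exists>n V. openin (T (s n)) V \<and> x \<in> V \<and> V \<subseteq> U))"
      using sup by (intro bexI[of _ "\<Union>n. s n"]) auto
  next
    fix P Q U x assume PQ: "P \<in> \<Gamma>" "Q \<in> \<Gamma>" "Q \<subseteq> P" and U: "openin (T P) U" "x \<in> U"
    \<comment> \<open>The open \<open>U\<close> misses the closure of the union of \<open>S\<close>,
      so \<open>x\<close> has a neighbourhood \<open>W\<close> in \<open>Q\<close> that misses all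
      of \<open>S\<close>. A member of \<open>Q\<close> that meets \<open>W\<close> is thus not in
      \<open>S\<close>, hence meets \<open>U\<close>; this puts \<open>W\<close> into the
      \<open>T Q\<close>-closure of \<open>U\<close>.\<close>
    define S where "S = {V \<in> Q. V \<inter> U = {}}"
    have XU: "openin X U" using coarser[OF PQ(1) U(1)] .
    have "U \<inter> \<Union>S = {}" by (auto simp: S_def)
    then have "U \<inter> X closure_of \<Union>S = {}" using openin_Int_closure_of_eq_empty[OF XU] by blast
    moreover have "x \<in> topspace X" using openin_subset[OF XU] U(2) by blast
    ultimately obtain W where W: "W \<in> Q" "x \<in> W" "W \<inter> \<Union>S = {}"
      using \<Gamma>_bang[OF PQ(2), of S x] U(2) by (auto simp: S_def)
    have "W \<subseteq> T Q closure_of U"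
    proof
      fix y assume y: "y \<in> W"
      show "y \<in> T Q closure_of U"
        unfolding in_closure_of
      proof (intro conjI allI impI)
        show "y \<in> topspace (T Q)"
          using y \<Gamma>_open[OF PQ(2) W(1)] openin_subset topspace_T[OF PQ(2)] by blast
        fix G assume "y \<in> G \<and> openin (T Q) G"
        then obtain V where V: "V \<in> Q" "y \<in> V" "V \<subseteq> G" using openin_T[OF PQ(2), of G] by auto
        then have "V \<notin> S" using W(3) y by blast
        then show "\<exists>z. z \<in> U \<and> z \<in> G" using V by (auto simp: S_def)
      qed
    qed
    moreover have "openin (T Q) W" using openin_T[OF PQ(2), of W] W(1) by auto
    ultimately show "\<exists>W. openin (T Q) W \<and> x \<in> W \<and> W \<subseteq> T Q closure_of U" using W(2) by blast
  qed auto
  then show ?thesis by blast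
qed

text \<open>Types cannot be quantified existentially inside a formula, so the first half names
  concrete ones: indices are families of subsets of \<open>X\<close>, ordered by inclusion in the
  construction, and points are singletons. The second half leaves the types of indices and points
  arbitrary.\<close>

theorem theorem3p3:
  fixes X :: "'a topology"
  assumes "Hausdorff_space X"
  shows "(very_I_favorable X \<longrightarrow>
            (\<exists>(\<Gamma> :: 'a set set set) le (Xs :: 'a set set \<Rightarrow> 'a set topology) q.
                good_system X \<Gamma> le Xs q))
       \<and> (\<forall>(\<Gamma> :: 'i set) le (Xs :: 'i \<Rightarrow> 'b topology) q.
                good_system X \<Gamma> le Xs q \<longrightarrow> very_I_favorable X)"
proof (intro conjI impI allI)
  assume "very_I_favorable X"
  then obtain \<Gamma> :: "'a set set set" and T where "topology_system X \<Gamma> (\<subseteq>) T"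
    using very_I_favorable_imp_topology_system by blast
  from topology_system.good_system_singleton_copies[OF this]
  show "\<exists>(\<Gamma> :: 'a set set set) le (Xs :: 'a set set \<Rightarrow> 'a set topology) q. good_system X \<Gamma> le Xs q"
    by blast
qed (rule good_system_imp_very_I_favorable)

end
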